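(* Let $k$ be a commutative unital ring with $\mathbb{Q}\subseteq k$. Mapping coisotropic DGLAs $\mathfrak g$ over $k$ to the quotient set $\mathrm{Def}(\mathfrak g)$ (and a morphism $\Phi$ to the maps induced on gauge classes by the $\lambda$-linear extensions of $\Phi_{\mathrm{tot}}$ and $\Phi_N$) defines a functor $\mathrm{Def}$ from the category of coisotropic DGLAs over $k$ to the category of coisotropic sets.
   Context: Coisotropic DGLA: two ($\mathbb Z$-graded) DGLAs $(\mathfrak g_{\mathrm{tot}}^\bullet,[\cdot,\cdot]_{\mathrm{tot}},d_{\mathrm{tot}})$ and $(\mathfrak g_N^\bullet,[\cdot,\cdot]_N,d_N)$ over $k$, a degree $0$ DGLA morphism $\iota_{\mathfrak g}\colon \mathfrak g_N\to\mathfrak g_{\mathrm{tot}}$, and a graded Lie ideal $\mathfrak g_0\subseteq \mathfrak g_N$ with $d_N(\mathfrak g_0^\bullet)\subseteq \mathfrak g_0^{\bullet+1}$. A morphism $\Phi\colon\mathfrak g\to\mathfrak h$ is a pair of DGLA morphisms $\Phi_{\mathrm{tot}},\Phi_N$ between the respective components with $\Phi_{\mathrm{tot}}\iota_{\mathfrak g}=\iota_{\mathfrak h}\Phi_N$ and $\Phi_N(\mathfrak g_0)\subseteq\mathfrak h_0$. Coisotropic set: sets $M_{\mathrm{tot}},M_N$ with a map $\iota_M\colon M_N\to M_{\mathrm{tot}}$ and an equivalence relation $\sim$ on $M_N$; a morphism is a pair of maps $f_{\mathrm{tot}},f_N$ commuting with $\iota$ such that $f_N$ preserves the equivalence relations.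 For an ordinary DGLA $\mathfrak h$, let $\lambda\mathfrak h[[\lambda]]$ be the DGLA of formal power series without constant term ($\lambda$-linearly extended structure), $\mathrm{MC}(\lambda\mathfrak h[[\lambda]])=\{\xi\in\lambda\mathfrak h^1[[\lambda]]: d\xi+\frac12[\xi,\xi]=0\}$ and $G(\mathfrak h)=\lambda\mathfrak h^0[[\lambda]]$, a group under the Baker-Campbell-Hausdorff multiplication, which acts on $\mathrm{MC}(\lambda\mathfrak h[[\lambda]])$ by $\lambda g\triangleright\xi = e^{\lambda\,\mathrm{ad}(g)}(\xi)-\lambda\sum_{j\ge0}\frac{(\lambda\,\mathrm{ad}(g))^j}{(1+j)!}(dg)$. For a coisotropic DGLA $\mathfrak g$ and $\xi_1,\xi_2\in\mathrm{MC}(\lambda\mathfrak g_N[[\lambda]])$ write $\xi_1\sim_{\mathrm{MC}}\xi_2$ iff $\xi_1-\xi_2\in\lambda\mathfrak g_0^1[[\lambda]]$. Then $\mathrm{Def}(\mathfrak g)$ is given by $\mathrm{Def}(\mathfrak g)_{\mathrm{tot}}=\mathrm{MC}(\lambda\mathfrak g_{\mathrm{tot}}[[\lambda]])/G(\mathfrak g_{\mathrm{tot}})$, $\mathrm{Def}(\mathfrak g)_N=\mathrm{MC}(\lambda\mathfrak g_N[[\lambda]])/G(\mathfrak g_N)$, the map $\mathrm{Def}(\mathfrak g)_N\to\mathrm{Def}(\mathfrak g)_{\mathrm{tot}}$ induced by $\iota_{\mathfrak g}$, and the equivalence relation on $\mathrm{Def}(\mathfrak g)_N$ defined by $[\xi_1]\sim[\xi_2]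 :\Leftrightarrow \xi_1\sim_{\mathrm{MC}}\xi_2$. *)

theory Defs
  imports "HOL-Algebra.Algebra" "HOL-Algebra.Algebraic_Closure_Type" "HOL-Library.Disjoint_Sets"
begin

section \<open>Categories and functors\<close>

text \<open>Hom-sets are indexed by pairs of objects and need not be disjoint;
  \<open>Comp C V W Z g f\<close> is the composite of \<open>f : V \<rightarrow> W\<close> and \<open>g : W \<rightarrow> Z\<close>.\<close>

record ('o, 'm) cat =
  Obj :: "'o set"
  Hom :: "'o \<Rightarrow> 'o \<Rightarrow> 'm set"
  Ident :: "'o \<Rightarrow> 'm"
  Comp :: "'o \<Rightarrow> 'o \<Rightarrow> 'o \<Rightarrow> 'm \<Rightarrow> 'm \<Rightarrow> 'm"

definition is_category :: "('o, 'm) cat \<Rightarrow> bool" where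
  "is_category C \<longleftrightarrow>
    (\<forall>V\<in>Obj C. Ident C V \<in> Hom C V V) \<and>
    (\<forall>V\<in>Obj C. \<forall>W\<in>Obj C. \<forall>Z\<in>Obj C. \<forall>f\<in>Hom C V W. \<forall>g\<in>Hom C W Z.
       Comp C V W Z g f \<in> Hom C V Z) \<and>
    (\<forall>V\<in>Obj C. \<forall>W\<in>Obj C. \<forall>f\<in>Hom C V W.
       Comp C V V W f (Ident C V) = f \<and> Comp C V W W (Ident C W) f = f) \<and>
    (\<forall>U\<in>Obj C. \<forall>V\<in>Obj C. \<forall>W\<in>Obj C. \<forall>Z\<in>Obj C.
       \<forall>f\<in>Hom C U V. \<forall>g\<in>Hom C V W. \<forall>h\<in>Hom C W Z.
         Comp C U W Z h (Comp C U V W g f) = Comp C U V Z (Comp C V W Z h g) f)"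

definition is_functor ::
  "('o, 'm) cat \<Rightarrow> ('p, 'n) cat \<Rightarrow> ('o \<Rightarrow> 'p) \<Rightarrow> ('o \<Rightarrow> 'o \<Rightarrow> 'm \<Rightarrow> 'n) \<Rightarrow> bool" where
  "is_functor C D F\<^sub>o F\<^sub>m \<longleftrightarrow>
    is_category C \<and> is_category D \<and>
    (\<forall>V\<in>Obj C. F\<^sub>o V \<in> Obj D) \<and>
    (\<forall>V\<in>Obj C. \<forall>W\<in>Obj C. \<forall>f\<in>Hom C V W. F\<^sub>m V W f \<in> Hom D (F\<^sub>o V) (F\<^sub>o W)) \<and>
    (\<forall>V\<in>Obj C. F\<^sub>m V V (Ident C V) = Ident D (F\<^sub>o V)) \<and>
    (\<forall>V\<in>Obj C. \<forall>W\<in>Obj C. \<forall>Z\<in>Obj C. \<forall>f\<in>Hom C V W. \<forall>g\<in>Hom C W Z.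
       F\<^sub>m V Z (Comp C V W Z g f)
         = Comp D (F\<^sub>o V) (F\<^sub>o W) (F\<^sub>o Z) (F\<^sub>m W Z g) (F\<^sub>m V W f))"


section \<open>Rational scalars\<close>

definition contains_rationals :: "('r, 'm) ring_scheme \<Rightarrow> bool" where
  "contains_rationals R \<longleftrightarrow>
    (\<exists>h \<in> ring_hom (ring_of_type_algebra :: rat ring) R. inj h)"

text \<open>A ring homomorphism out of the rationals is unique, so the choice is harmless.\<close>

definition rat_embed :: "('r, 'm) ring_scheme \<Rightarrow> rat \<Rightarrow> 'r" where
  "rat_embed R = (SOME h. h \<in> ring_hom (ring_of_type_algebra :: rat ring) R)"


section \<open>Differential graded Lie algebras\<close>

text \<open>A graded module is a family of modules indexed by the integers. Elements of different
  degrees may be represented by the same element of the carrier type, so the bracket and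
  the differential take the degrees of their arguments as parameters. The ring fields
  \<open>mult\<close> and \<open>one\<close> that the record type \<open>module\<close> inherits play no role.\<close>

record ('r, 'a) dgla =
  Deg :: "int \<Rightarrow> ('r, 'a) module"
  Bracket :: "int \<Rightarrow> int \<Rightarrow> 'a \<Rightarrow> 'a \<Rightarrow> 'a"
  Diff :: "int \<Rightarrow> 'a \<Rightarrow> 'a"

definition signed :: "('a, 'm) ring_scheme \<Rightarrow> int \<Rightarrow> 'a \<Rightarrow> 'a" where
  "signed M k x = (if even k then x else \<ominus>\<^bsub>M\<^esub> x)"  \<comment> \<open>\<open>(-1)\<close> to the power \<open>k\<close>, times \<open>x\<close>\<close>

definition linear_maps ::
  "('r, 'm) ring_scheme \<Rightarrow> ('r, 'a) module \<Rightarrow> ('r, 'b) module \<Rightarrow> ('a \<Rightarrow> 'b) set" where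
  "linear_maps R M N = {f \<in> carrier M \<rightarrow> carrier N.
     (\<forall>x\<in>carrier M. \<forall>y\<in>carrier M. f (x \<oplus>\<^bsub>M\<^esub> y) = f x \<oplus>\<^bsub>N\<^esub> f y) \<and>
     (\<forall>a\<in>carrier R. \<forall>x\<in>carrier M. f (a \<odot>\<^bsub>M\<^esub> x) = a \<odot>\<^bsub>N\<^esub> f x)}"

locale dgla =
  fixes R :: "('r, 'm) ring_scheme" and L :: "('r, 'a) dgla"
  assumes module_Deg: "module R (Deg L i)"
    and bracket_linear_left:
      "y \<in> carrier (Deg L j) \<Longrightarrow>
        (\<lambda>x. Bracket L i j x y) \<in> linear_maps R (Deg L i) (Deg L (i + j))"
    and bracket_linear_right:
      "x \<in> carrier (Deg L i) \<Longrightarrow>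
        (\<lambda>y. Bracket L i j x y) \<in> linear_maps R (Deg L j) (Deg L (i + j))"
    and bracket_antisym:
      "\<lbrakk>x \<in> carrier (Deg L i); y \<in> carrier (Deg L j)\<rbrakk> \<Longrightarrow>
        Bracket L i j x y = \<ominus>\<^bsub>Deg L (i + j)\<^esub> signed (Deg L (i + j)) (i * j) (Bracket L j i y x)"
    and jacobi:
      "\<lbrakk>x \<in> carrier (Deg L i); y \<in> carrier (Deg L j); z \<in> carrier (Deg L k)\<rbrakk> \<Longrightarrow>
        Bracket L i (j + k) x (Bracket L j k y z)
          = Bracket L (i + j) k (Bracket L i j x y) z \<oplus>\<^bsub>Deg L (i + j + k)\<^esub>
            signed (Deg L (i + j + k)) (i * j) (Bracket L j (i + k) y (Bracket L i k x z))"
    and diff_linear: "Diff L i \<in> linear_maps R (Deg L i) (Deg L (i + 1))"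
    and diff_diff:
      "x \<in> carrier (Deg L i) \<Longrightarrow> Diff L (i + 1) (Diff L i x) = \<zero>\<^bsub>Deg L (i + 2)\<^esub>"
    and diff_bracket:
      "\<lbrakk>x \<in> carrier (Deg L i); y \<in> carrier (Deg L j)\<rbrakk> \<Longrightarrow>
        Diff L (i + j) (Bracket L i j x y)
          = Bracket L (i + 1) j (Diff L i x) y \<oplus>\<^bsub>Deg L (i + j + 1)\<^esub>
            signed (Deg L (i + j + 1)) i (Bracket L i (j + 1) x (Diff L j y))"

definition dgla_maps ::
  "('r, 'm) ring_scheme \<Rightarrow> ('r, 'a) dgla \<Rightarrow> ('r, 'b) dgla \<Rightarrow> (int \<Rightarrow> 'a \<Rightarrow> 'b) set" where
  "dgla_maps R L K = {\<Phi>.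
     (\<forall>i. \<Phi> i \<in> linear_maps R (Deg L i) (Deg K i)) \<and>
     (\<forall>i j. \<forall>x\<in>carrier (Deg L i). \<forall>y\<in>carrier (Deg L j).
        \<Phi> (i + j) (Bracket L i j x y) = Bracket K i j (\<Phi> i x) (\<Phi> j y)) \<and>
     (\<forall>i. \<forall>x\<in>carrier (Deg L i). \<Phi> (i + 1) (Diff L i x) = Diff K i (\<Phi> i x))}"


section \<open>The category of coisotropic DGLAs\<close>

record ('r, 'a, 'b) codgla =
  Tot :: "('r, 'a) dgla"
  Nor :: "('r, 'b) dgla"
  iota :: "int \<Rightarrow> 'b \<Rightarrow> 'a"
  Ideal0 :: "int \<Rightarrow> 'b set"

locale coisotropic_dgla =
  fixes R :: "('r, 'm) ring_scheme" and G :: "('r, 'a, 'b) codgla"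
  assumes Tot: "dgla R (Tot G)"
    and Nor: "dgla R (Nor G)"
    and iota: "iota G \<in> dgla_maps R (Nor G) (Tot G)"
    and Ideal0_submodule: "submodule (Ideal0 G i) R (Deg (Nor G) i)"
    and Ideal0_bracket:
      "\<lbrakk>x \<in> carrier (Deg (Nor G) i); y \<in> Ideal0 G j\<rbrakk> \<Longrightarrow>
        Bracket (Nor G) i j x y \<in> Ideal0 G (i + j)"
    and Ideal0_diff: "y \<in> Ideal0 G i \<Longrightarrow> Diff (Nor G) i y \<in> Ideal0 G (i + 1)"

text \<open>Morphisms are extensional functions (equal to \<open>undefined\<close> outside the carriers), so that
  equality of morphisms is equality of maps on the carriers.\<close>

definition coisotropic_dgla_maps ::
  "('r, 'm) ring_scheme \<Rightarrow> ('r, 'a, 'b) codgla \<Rightarrow> ('r, 'c, 'd) codgla \<Rightarrow>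
     ((int \<Rightarrow> 'a \<Rightarrow> 'c) \<times> (int \<Rightarrow> 'b \<Rightarrow> 'd)) set" where
  "coisotropic_dgla_maps R G H = {(\<Phi>t, \<Phi>n).
     \<Phi>t \<in> dgla_maps R (Tot G) (Tot H) \<and> (\<forall>i. \<Phi>t i \<in> extensional (carrier (Deg (Tot G) i))) \<and>
     \<Phi>n \<in> dgla_maps R (Nor G) (Nor H) \<and> (\<forall>i. \<Phi>n i \<in> extensional (carrier (Deg (Nor G) i))) \<and>
     (\<forall>i. \<forall>x\<in>carrier (Deg (Nor G) i). \<Phi>t i (iota G i x) = iota H i (\<Phi>n i x)) \<and>
     (\<forall>i. \<Phi>n i ` Ideal0 G i \<subseteq> Ideal0 H i)}"

definition coisotropic_dgla_cat ::
  "('r, 'm) ring_scheme \<Rightarrow>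
     (('r, 'a, 'b) codgla, (int \<Rightarrow> 'a \<Rightarrow> 'a) \<times> (int \<Rightarrow> 'b \<Rightarrow> 'b)) cat" where
  "coisotropic_dgla_cat R = \<lparr>
     Obj = {G. coisotropic_dgla R G},
     Hom = coisotropic_dgla_maps R,
     Ident = (\<lambda>G. (\<lambda>i. \<lambda>x\<in>carrier (Deg (Tot G) i). x, \<lambda>i. \<lambda>x\<in>carrier (Deg (Nor G) i). x)),
     Comp = (\<lambda>G H K \<Psi> \<Phi>.
       (\<lambda>i. compose (carrier (Deg (Tot G) i)) (fst \<Psi> i) (fst \<Phi> i),
        \<lambda>i. compose (carrier (Deg (Nor G) i)) (snd \<Psi> i) (snd \<Phi> i)))\<rparr>"


section \<open>The category of coisotropic sets\<close>

record ('p, 'q) coiso_set =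
  STot :: "'p set"
  SNor :: "'q set"
  siota :: "'q \<Rightarrow> 'p"
  Sim :: "('q \<times> 'q) set"

definition coisotropic_set :: "('p, 'q) coiso_set \<Rightarrow> bool" where
  "coisotropic_set M \<longleftrightarrow> siota M \<in> SNor M \<rightarrow> STot M \<and> equiv (SNor M) (Sim M)"

definition coisotropic_set_maps ::
  "('p, 'q) coiso_set \<Rightarrow> ('u, 'v) coiso_set \<Rightarrow> (('p \<Rightarrow> 'u) \<times> ('q \<Rightarrow> 'v)) set" where
  "coisotropic_set_maps M N = {(ft, fn).
     ft \<in> STot M \<rightarrow>\<^sub>E STot N \<and> fn \<in> SNor M \<rightarrow>\<^sub>E SNor N \<and>
     (\<forall>x\<in>SNor M. ft (siota M x) = siota N (fn x)) \<and>
     (\<forall>x y. (x, y) \<in> Sim M \<longrightarrow> (fn x, fn y) \<in> Sim N)}"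

definition coisotropic_set_cat ::
  "(('p, 'q) coiso_set, ('p \<Rightarrow> 'p) \<times> ('q \<Rightarrow> 'q)) cat" where
  "coisotropic_set_cat = \<lparr>
     Obj = {M. coisotropic_set M},
     Hom = coisotropic_set_maps,
     Ident = (\<lambda>M. (\<lambda>x\<in>STot M. x, \<lambda>x\<in>SNor M. x)),
     Comp = (\<lambda>M N P g f. (compose (STot M) (fst g) (fst f), compose (SNor M) (snd g) (snd f)))\<rparr>"


section \<open>Formal Maurer--Cartan elements and gauge action\<close>

text \<open>A power series is its coefficient sequence. Degree by degree, \<open>formal R L\<close> consists of the
  power series with coefficients in \<open>L\<close> whose constant term vanishes.\<close>

definition formal_module :: "('r, 'a) module \<Rightarrow> ('r, nat \<Rightarrow> 'a) module" where
  "formal_module M = \<lparr>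
     carrier = {f. f 0 = \<zero>\<^bsub>M\<^esub> \<and> (\<forall>n. f n \<in> carrier M)},
     monoid.mult = undefined, one = undefined,
     ring.zero = (\<lambda>n. \<zero>\<^bsub>M\<^esub>),
     ring.add = (\<lambda>f g n. f n \<oplus>\<^bsub>M\<^esub> g n),
     module.smult = (\<lambda>a f n. a \<odot>\<^bsub>M\<^esub> f n)\<rparr>"

definition formal :: "('r, 'a) dgla \<Rightarrow> ('r, nat \<Rightarrow> 'a) dgla" where
  "formal L = \<lparr>
     Deg = (\<lambda>i. formal_module (Deg L i)),
     Bracket = (\<lambda>i j f g n. \<Oplus>\<^bsub>Deg L (i + j)\<^esub> p\<in>{..n}. Bracket L i j (f p) (g (n - p))),
     Diff = (\<lambda>i f n. Diff L i (f n))\<rparr>"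

definition formal_map :: "('a \<Rightarrow> 'b) \<Rightarrow> (nat \<Rightarrow> 'a) \<Rightarrow> (nat \<Rightarrow> 'b)" where
  "formal_map \<phi> f = (\<lambda>n. \<phi> (f n))"

definition MC :: "('r, 'm) ring_scheme \<Rightarrow> ('r, 'a) dgla \<Rightarrow> 'a set" where
  "MC R L = {\<xi> \<in> carrier (Deg L 1).
     Diff L 1 \<xi> \<oplus>\<^bsub>Deg L 2\<^esub> rat_embed R (1 / 2) \<odot>\<^bsub>Deg L 2\<^esub> Bracket L 1 1 \<xi> \<xi> = \<zero>\<^bsub>Deg L 2\<^esub>}"

fun nested_bracket :: "('r, 'a) dgla \<Rightarrow> 'a list \<Rightarrow> 'a" where
  "nested_bracket L [] = \<zero>\<^bsub>Deg L 0\<^esub>"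
| "nested_bracket L [x] = x"
| "nested_bracket L (x # y # zs) = Bracket L 0 0 x (nested_bracket L (y # zs))"

text \<open>Dynkin's form of the Baker--Campbell--Hausdorff series: the sum, over all nonempty
  sequences of pairs \<open>(r\<^sub>1, s\<^sub>1), \<dots>, (r\<^sub>n, s\<^sub>n)\<close> with \<open>r\<^sub>i + s\<^sub>i > 0\<close>, of the right-nested brackets of
  \<open>x\<^sup>r\<^sup>1 y\<^sup>s\<^sup>1 \<dots> x\<^sup>r\<^sup>n y\<^sup>s\<^sup>n\<close> with coefficient \<open>dynkin_coeff\<close>. As \<open>x\<close> and \<open>y\<close> have no constant term, a word
  of length greater than \<open>m\<close> does not contribute to the coefficient at \<open>m\<close>.\<close>

definition dynkin_coeff :: "(nat \<times> nat) list \<Rightarrow> rat" where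
  "dynkin_coeff ps =
     (-1) ^ (length ps - 1) /
     (of_nat (length ps) * of_nat (\<Sum>(r, s)\<leftarrow>ps. r + s) * (\<Prod>(r, s)\<leftarrow>ps. fact r * fact s))"

definition bch ::
  "('r, 'm) ring_scheme \<Rightarrow> ('r, 'a) dgla \<Rightarrow> (nat \<Rightarrow> 'a) \<Rightarrow> (nat \<Rightarrow> 'a) \<Rightarrow> (nat \<Rightarrow> 'a)" where
  "bch R L x y = (\<lambda>m. \<Oplus>\<^bsub>Deg L 0\<^esub>
     ps \<in> {ps. ps \<noteq> [] \<and> (\<forall>(r, s)\<in>set ps. 0 < r + s) \<and> (\<Sum>(r, s)\<leftarrow>ps. r + s) \<le> m}.
       rat_embed R (dynkin_coeff ps) \<odot>\<^bsub>Deg L 0\<^esub>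
         nested_bracket (formal L) (concat (map (\<lambda>(r, s). replicate r x @ replicate s y) ps)) m)"

definition gauge_group :: "('r, 'm) ring_scheme \<Rightarrow> ('r, 'a) dgla \<Rightarrow> (nat \<Rightarrow> 'a) monoid" where
  "gauge_group R L = \<lparr>
     carrier = carrier (Deg (formal L) 0),
     monoid.mult = bch R L,
     one = \<zero>\<^bsub>Deg (formal L) 0\<^esub>\<rparr>"

text \<open>The group element \<open>x\<close> is \<open>\<lambda>g\<close> in the usual notation. As \<open>x\<close> has no constant term, the
  \<open>j\<close>-th power of its adjoint action does not contribute to the coefficient at \<open>m\<close> if \<open>j > m\<close>.\<close>

definition gauge_act ::
  "('r, 'm) ring_scheme \<Rightarrow> ('r, 'a) dgla \<Rightarrow> (nat \<Rightarrow> 'a) \<Rightarrow> (nat \<Rightarrow> 'a) \<Rightarrow> (nat \<Rightarrow> 'a)" where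
  "gauge_act R L x \<xi> = (\<lambda>m.
     (\<Oplus>\<^bsub>Deg L 1\<^esub> j\<in>{..m}. rat_embed R (1 / fact j) \<odot>\<^bsub>Deg L 1\<^esub>
        (Bracket (formal L) 0 1 x ^^ j) \<xi> m)
     \<ominus>\<^bsub>Deg L 1\<^esub>
     (\<Oplus>\<^bsub>Deg L 1\<^esub> j\<in>{..m}. rat_embed R (1 / fact (1 + j)) \<odot>\<^bsub>Deg L 1\<^esub>
        (Bracket (formal L) 0 1 x ^^ j) (Diff (formal L) 0 x) m))"


section \<open>The deformation functor\<close>

definition gauge_class ::
  "('r, 'm) ring_scheme \<Rightarrow> ('r, 'a) dgla \<Rightarrow> (nat \<Rightarrow> 'a) \<Rightarrow> (nat \<Rightarrow> 'a) set" where
  "gauge_class R L \<xi> = orbit (gauge_group R L) (gauge_act R L) \<xi>"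

definition gauge_quotient ::
  "('r, 'm) ring_scheme \<Rightarrow> ('r, 'a) dgla \<Rightarrow> (nat \<Rightarrow> 'a) set set" where
  "gauge_quotient R L = orbits (gauge_group R L) (MC R (formal L)) (gauge_act R L)"

text \<open>The map sending the class of \<open>\<xi>\<close> to the class of \<open>\<phi> \<xi>\<close>, where \<open>\<phi>\<close> is applied to coefficients.\<close>

definition induced_map ::
  "('r, 'm) ring_scheme \<Rightarrow> ('r, 'a) dgla \<Rightarrow> ('r, 'b) dgla \<Rightarrow> ('a \<Rightarrow> 'b) \<Rightarrow>
     (nat \<Rightarrow> 'a) set \<Rightarrow> (nat \<Rightarrow> 'b) set" where
  "induced_map R L K \<phi> =
     (\<lambda>C\<in>gauge_quotient R L. \<Union>\<xi>\<in>C. gauge_class R K (formal_map \<phi> \<xi>))"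

definition MC_sim ::
  "('r, 'm) ring_scheme \<Rightarrow> ('r, 'a, 'b) codgla \<Rightarrow> ((nat \<Rightarrow> 'b) \<times> (nat \<Rightarrow> 'b)) set" where
  "MC_sim R G = {(\<xi>\<^sub>1, \<xi>\<^sub>2). \<xi>\<^sub>1 \<in> MC R (formal (Nor G)) \<and> \<xi>\<^sub>2 \<in> MC R (formal (Nor G)) \<and>
     (\<forall>n. (\<xi>\<^sub>1 \<ominus>\<^bsub>Deg (formal (Nor G)) 1\<^esub> \<xi>\<^sub>2) n \<in> Ideal0 G 1)}"

text \<open>Two gauge classes are equivalent if they have equivalent representatives. It cannot be required
  of all representatives: for a vanishing ideal, \<open>MC_sim\<close> is equality.\<close>

definition Def_obj ::
  "('r, 'm) ring_scheme \<Rightarrow> ('r, 'a, 'b) codgla \<Rightarrow> ((nat \<Rightarrow> 'a) set, (nat \<Rightarrow> 'b) set) coiso_set" where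
  "Def_obj R G = \<lparr>
     STot = gauge_quotient R (Tot G),
     SNor = gauge_quotient R (Nor G),
     siota = induced_map R (Nor G) (Tot G) (iota G 1),
     Sim = {(C, D). C \<in> gauge_quotient R (Nor G) \<and> D \<in> gauge_quotient R (Nor G) \<and>
              (\<exists>\<xi>\<^sub>1\<in>C. \<exists>\<xi>\<^sub>2\<in>D. (\<xi>\<^sub>1, \<xi>\<^sub>2) \<in> MC_sim R G)}\<rparr>"

definition Def_mor ::
  "('r, 'm) ring_scheme \<Rightarrow> ('r, 'a, 'b) codgla \<Rightarrow> ('r, 'c, 'd) codgla \<Rightarrow>
     (int \<Rightarrow> 'a \<Rightarrow> 'c) \<times> (int \<Rightarrow> 'b \<Rightarrow> 'd) \<Rightarrow>
     ((nat \<Rightarrow> 'a) set \<Rightarrow> (nat \<Rightarrow> 'c) set) \<times> ((nat \<Rightarrow> 'b) set \<Rightarrow> (nat \<Rightarrow> 'd) set)" where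
  "Def_mor R G H \<Phi> =
     (induced_map R (Tot G) (Tot H) (fst \<Phi> 1), induced_map R (Nor G) (Nor H) (snd \<Phi> 1))"

text \<open>The gauge classes partition the Maurer--Cartan elements, and the maps \<open>siota\<close> of \<open>Def_obj\<close> and
  \<open>Def_mor\<close> are given on the class of any Maurer--Cartan element by the class of its image.\<close>

definition Def_well_defined_obj :: "('r, 'm) ring_scheme \<Rightarrow> ('r, 'a, 'b) codgla \<Rightarrow> bool" where
  "Def_well_defined_obj R G \<longleftrightarrow>
     partition_on (MC R (formal (Tot G))) (gauge_quotient R (Tot G)) \<and>
     partition_on (MC R (formal (Nor G))) (gauge_quotient R (Nor G)) \<and>
     (\<forall>\<xi>\<in>MC R (formal (Nor G)).
        formal_map (iota G 1) \<xi> \<in> MC R (formal (Tot G)) \<and>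
        siota (Def_obj R G) (gauge_class R (Nor G) \<xi>)
          = gauge_class R (Tot G) (formal_map (iota G 1) \<xi>))"

definition Def_well_defined_mor ::
  "('r, 'm) ring_scheme \<Rightarrow> ('r, 'a, 'b) codgla \<Rightarrow> ('r, 'c, 'd) codgla \<Rightarrow>
     (int \<Rightarrow> 'a \<Rightarrow> 'c) \<times> (int \<Rightarrow> 'b \<Rightarrow> 'd) \<Rightarrow> bool" where
  "Def_well_defined_mor R G H \<Phi> \<longleftrightarrow>
     (\<forall>\<xi>\<in>MC R (formal (Tot G)).
        formal_map (fst \<Phi> 1) \<xi> \<in> MC R (formal (Tot H)) \<and>
        fst (Def_mor R G H \<Phi>) (gauge_class R (Tot G) \<xi>)
          = gauge_class R (Tot H) (formal_map (fst \<Phi> 1) \<xi>)) \<and>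
     (\<forall>\<xi>\<in>MC R (formal (Nor G)).
        formal_map (snd \<Phi> 1) \<xi> \<in> MC R (formal (Nor H)) \<and>
        snd (Def_mor R G H \<Phi>) (gauge_class R (Nor G) \<xi>)
          = gauge_class R (Nor H) (formal_map (snd \<Phi> 1) \<xi>))"

end

theory Submission
  imports Defs "HOL-Library.Function_Algebras" "HOL-Library.Product_Plus" "HOL-Library.Poly_Mapping"
begin

text \<open>Only the orbits of the gauge action matter, so the Baker--Campbell--Hausdorff series need not be
  evaluated: it suffices that for all \<open>x\<close>, \<open>y\<close> there is some \<open>z\<close> with \<open>e\<^sup>x e\<^sup>y = e\<^sup>z\<close> on representations.
  Let \<open>\<theta> = \<lambda> d/d\<lambda>\<close>. Then \<open>[\<theta>, e\<^sup>x] = \<psi>(x) e\<^sup>x\<close>, where \<open>\<psi>(x)\<close> is the sum of the \<open>ad(x)\<^sup>j(\<theta> x) / (j + 1)!\<close>, and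
  \<open>e\<^sup>x\<close> is determined by \<open>\<psi>(x)\<close>. Since \<open>\<psi>(z)\<close> has \<open>n\<close>-th coefficient \<open>n z\<^sub>n\<close> plus terms in \<open>z\<^sub>1, \<dots>, z\<^sub>n\<^sub>-\<^sub>1\<close>,
  the equation \<open>\<psi>(z) = \<psi>(x) + exp(ad x) \<psi>(y)\<close> for the product can be solved recursively, and so can the one for
  the inverse. Adjoining an element \<open>\<delta>\<close> with \<open>[\<delta>, x] = d x\<close> turns the gauge action into the adjoint
  action on \<open>\<delta> + \<xi>\<close> and the Maurer--Cartan equation into \<open>[\<delta> + \<xi>, \<delta> + \<xi>] = 0\<close>, which \<open>e\<^sup>x\<close> preserves.
  The relation on classes is transitive because \<open>x \<triangleright> \<xi> - x \<triangleright> \<eta> = exp(ad x)(\<xi> - \<eta>)\<close> stays in the ideal.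

  For the computations with series, each module is embedded, as a rational vector space, into a type
  of finitely supported functions, and the operations are transported along a linear retraction.\<close>

section \<open>Rational vector spaces and biadditive maps\<close>

text \<open>As a type class the structure passes to sequences, pairs and finitely supported
  functions, so that computations with series need no carrier conditions.\<close>

class rat_vector = ab_group_add +
  fixes scaleQ :: "rat \<Rightarrow> 'a \<Rightarrow> 'a" (infixr \<open>*\<^sub>Q\<close> 75)
  assumes scaleQ_add_right: "a *\<^sub>Q (x + y) = a *\<^sub>Q x + a *\<^sub>Q y"
    and scaleQ_add_left: "(a + b) *\<^sub>Q x = a *\<^sub>Q x + b *\<^sub>Q x"
    and scaleQ_scaleQ [simp]: "a *\<^sub>Q b *\<^sub>Q x = (a * b) *\<^sub>Q x"
    and scaleQ_one [simp]: "1 *\<^sub>Q x = x"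

global_interpretation rat_vector: vector_space "scaleQ :: rat \<Rightarrow> 'a \<Rightarrow> 'a :: rat_vector"
  by unfold_locales (simp_all add: scaleQ_add_right scaleQ_add_left)

instantiation "fun" :: (type, rat_vector) rat_vector
begin
definition "scaleQ_fun q f = (\<lambda>x. q *\<^sub>Q f x)"
instance by standard (simp_all add: scaleQ_fun_def fun_eq_iff scaleQ_add_right scaleQ_add_left)
end

lemma scaleQ_fun_apply [simp]: "(q *\<^sub>Q f) x = q *\<^sub>Q f x"
  by (simp add: scaleQ_fun_def)

lemma sum_fun_apply: "(\<Sum>i\<in>A. f i) x = (\<Sum>i\<in>A. f i x)"
  by (induction A rule: infinite_finite_induct) auto

instantiation rat :: rat_vector
begin
definition "scaleQ_rat q (x :: rat) = q * x"
instance by standard (simp_all add: scaleQ_rat_def algebra_simps)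
end

instantiation prod :: (rat_vector, rat_vector) rat_vector
begin
definition "scaleQ_prod q p = (q *\<^sub>Q fst p, q *\<^sub>Q snd p)"
instance by standard (simp_all add: scaleQ_prod_def prod_eq_iff scaleQ_add_right scaleQ_add_left)
end

lemma fst_scaleQ [simp]: "fst (q *\<^sub>Q p) = q *\<^sub>Q fst p"
  and snd_scaleQ [simp]: "snd (q *\<^sub>Q p) = q *\<^sub>Q snd p"
  by (simp_all add: scaleQ_prod_def)

instantiation poly_mapping :: (type, rat_vector) rat_vector
begin
definition "scaleQ_poly_mapping q p = Poly_Mapping.map (scaleQ q) p"
instance
proof -
  have lookup: "poly_mapping.lookup (Poly_Mapping.map (scaleQ q) p) k = q *\<^sub>Q poly_mapping.lookup p k"
    for q and p :: "'c \<Rightarrow>\<^sub>0 'd::rat_vector" and k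
    by (simp add: Poly_Mapping.map.rep_eq when_def)
  show "OFCLASS('a \<Rightarrow>\<^sub>0 'b, rat_vector_class)"
    by standard
      (auto intro!: poly_mapping_eqI
        simp: scaleQ_poly_mapping_def lookup lookup_add scaleQ_add_right scaleQ_add_left)
qed
end

lemma lookup_scaleQ [simp]: "poly_mapping.lookup (q *\<^sub>Q p) k = q *\<^sub>Q poly_mapping.lookup p k"
  by (simp add: scaleQ_poly_mapping_def Poly_Mapping.map.rep_eq when_def)

text \<open>Additivity gives compatibility with integer multiples, and a denominator can be
  cancelled because a nonzero rational acts injectively.\<close>

lemma additive_scaleQ:
  fixes f :: "'a::rat_vector \<Rightarrow> 'b::rat_vector"
  assumes "additive f"
  shows "f (q *\<^sub>Q x) = q *\<^sub>Q f x"
proof -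
  interpret additive f by fact
  have nat: "f (of_nat n *\<^sub>Q x) = of_nat n *\<^sub>Q f x" for n x
    by (induction n) (simp_all add: zero add scaleQ_add_left)
  have int: "f (of_int k *\<^sub>Q x) = of_int k *\<^sub>Q f x" for k x
  proof (cases k)
    case (neg n)
    then have "of_int k = - (of_nat (Suc n) :: rat)" by simp
    then show ?thesis by (simp only: rat_vector.scale_minus_left minus nat)
  qed (simp add: nat)
  obtain a b where ab: "quotient_of q = (a, b)"
    by fastforce
  then have q: "q = of_int a / of_int b" and b: "b \<noteq> 0"
    using quotient_of_div quotient_of_denom_pos by fastforce+
  have "of_int b *\<^sub>Q f (q *\<^sub>Q x) = f (of_int b *\<^sub>Q q *\<^sub>Q x)"
    by (simp only: int)
  also have "\<dots> = of_int b *\<^sub>Q q *\<^sub>Q f x"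
    using b by (simp add: q int)
  finally show ?thesis
    using b by (simp del: scaleQ_scaleQ)
qed

text \<open>Additivity in each argument is enough to ask for: rational bilinearity follows by
  \<open>additive_scaleQ\<close>.\<close>

locale biadditive =
  fixes b :: "'a::rat_vector \<Rightarrow> 'b::rat_vector \<Rightarrow> 'c::rat_vector"
  assumes add_left: "b (x + x') y = b x y + b x' y"
    and add_right: "b x (y + y') = b x y + b x y'"
begin

sublocale left: additive "\<lambda>x. b x y"
  by standard (rule add_left)

sublocale right: additive "b x"
  by standard (rule add_right)

lemmas zero_left = left.zero
lemmas zero_right = right.zero
lemmas scale_left = additive_scaleQ[OF left.additive_axioms]
lemmas scale_right = additive_scaleQ[OF right.additive_axioms]

end

section \<open>Power series\<close>

text \<open>The Cauchy product, with an arbitrary pairing of the coefficients, so that brackets and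
  actions are treated alike.\<close>

definition conv :: "('a \<Rightarrow> 'b \<Rightarrow> 'c::comm_monoid_add) \<Rightarrow> (nat \<Rightarrow> 'a) \<Rightarrow> (nat \<Rightarrow> 'b) \<Rightarrow> nat \<Rightarrow> 'c" where
  "conv b x y n = (\<Sum>p\<le>n. b (x p) (y (n - p)))"

text \<open>Both ways of bracketing a triple Cauchy product become sums over this one index set, so
  identities between coefficients, such as the Jacobi identity, pass to series.\<close>

definition trip :: "(nat \<Rightarrow> nat \<Rightarrow> nat \<Rightarrow> 'c::comm_monoid_add) \<Rightarrow> nat \<Rightarrow> 'c" where
  "trip F n = (\<Sum>(i, j, k) \<in> {(i, j, k). i + j + k = n}. F i j k)"

lemma trip_add: "trip (\<lambda>i j k. F i j k + G i j k) n = trip F n + trip G n"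
  unfolding trip_def by (simp add: sum.distrib split_def)

lemma trip_swap: "trip (\<lambda>i j k. F j i k) n = trip F n"
  unfolding trip_def
  by (rule sum.reindex_bij_witness[of _ "\<lambda>(i, j, k). (j, i, k)" "\<lambda>(i, j, k). (j, i, k)"]) auto

context biadditive
begin

lemma biadditive_conv: "biadditive (conv b)"
  by standard (simp_all add: conv_def fun_eq_iff add_left add_right sum.distrib)

lemma conv_conv_right:
  "conv b x (conv g y z) n = trip (\<lambda>i j k. b (x i) (g (y j) (z k))) n"
proof -
  have "conv b x (conv g y z) n =
      (\<Sum>(i, j)\<in>(SIGMA i:{..n}. {..n - i}). b (x i) (g (y j) (z (n - i - j))))"
    by (simp add: conv_def right.sum sum.Sigma)
  also have "\<dots> = trip (\<lambda>i j k. b (x i) (g (y j) (z k))) n"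
    unfolding trip_def
    by (rule sum.reindex_bij_witness[of _ "\<lambda>(i, j, k). (i, j)" "\<lambda>(i, j). (i, j, n - i - j)"]) auto
  finally show ?thesis .
qed

lemma conv_conv_left:
  "conv b (conv g x y) z n = trip (\<lambda>i j k. b (g (x i) (y j)) (z k)) n"
proof -
  have "conv b (conv g x y) z n =
      (\<Sum>(m, i)\<in>(SIGMA m:{..n}. {..m}). b (g (x i) (y (m - i))) (z (n - m)))"
    by (simp add: conv_def left.sum sum.Sigma)
  also have "\<dots> = trip (\<lambda>i j k. b (g (x i) (y j)) (z k)) n"
    unfolding trip_def
    by (rule sum.reindex_bij_witness[of _ "\<lambda>(i, j, k). (i + j, i)" "\<lambda>(m, i). (i, m - i, n - m)"]) auto
  finally show ?thesis .
qed

end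

text \<open>Divisibility by the \<open>n\<close>-th power of \<lambda>; this filtration is what
  makes infinite sums finite in every coefficient.\<close>

definition vanish :: "nat \<Rightarrow> (nat \<Rightarrow> 'a::zero) \<Rightarrow> bool" where
  "vanish n u \<longleftrightarrow> (\<forall>m<n. u m = 0)"

lemma vanishD: "vanish n u \<Longrightarrow> m < n \<Longrightarrow> u m = 0"
  by (simp add: vanish_def)

lemma vanish_0 [simp]: "vanish 0 u"
  by (simp add: vanish_def)

lemma vanish_Suc_0 [simp]: "vanish (Suc 0) u \<longleftrightarrow> u 0 = 0"
  by (simp add: vanish_def)

lemma vanish_scaleQ: "vanish n u \<Longrightarrow> vanish n (q *\<^sub>Q u)"
  by (simp add: vanish_def)

lemma (in biadditive) vanish_conv:
  assumes "vanish i x" "vanish j y"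
  shows "vanish (i + j) (conv b x y)"
  unfolding vanish_def conv_def
proof (intro allI impI sum.neutral ballI)
  fix n p assume "n < i + j" "p \<in> {..n}"
  then have "p < i \<or> n - p < j" by auto
  then show "b (x p) (y (n - p)) = 0"
    using assms by (auto simp: vanish_def left.zero right.zero)
qed

text \<open>The infinite sum of the \<open>u j\<close>, provided that each \<open>u j\<close> vanishes to order \<open>j\<close>.\<close>

definition ssum :: "(nat \<Rightarrow> nat \<Rightarrow> 'a::comm_monoid_add) \<Rightarrow> nat \<Rightarrow> 'a" where
  "ssum u n = (\<Sum>j\<le>n. u j n)"

text \<open>Any cutoff from \<open>n\<close> on gives the same coefficient, so the coefficients
  inside a product can all be cut off at a common bound.\<close>

lemma ssum_eq:
  assumes "\<And>j. vanish j (u j)" "n \<le> N"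
  shows "ssum u n = (\<Sum>j\<le>N. u j n)"
  unfolding ssum_def using assms by (intro sum.mono_neutral_left) (auto simp: vanish_def)

lemma ssum_add: "ssum (\<lambda>j. u j + w j) = ssum u + ssum w"
  by (simp add: ssum_def fun_eq_iff sum.distrib)

lemma ssum_single: "ssum (\<lambda>j. if j = 0 then u else 0) = u"
  by (auto simp: ssum_def fun_eq_iff if_distrib[of "\<lambda>f. f _"] cong: if_cong)

text \<open>Orders add under products. In coefficient \<open>n\<close> the square of index pairs
  therefore shrinks to the triangle \<open>i + k \<le> n\<close>, which is then summed along its
  antidiagonals.\<close>

lemma (in biadditive) conv_ssum:
  assumes u: "\<And>j. vanish j (u j)" and w: "\<And>j. vanish j (w j)"
  shows "conv b (ssum u) (ssum w) = ssum (\<lambda>j. \<Sum>i\<le>j. conv b (u i) (w (j - i)))"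
proof
  fix n
  have vanish_conv_n: "conv b (u i) (w k) n = 0" if "\<not> i + k \<le> n" for i k
    using that vanishD[OF vanish_conv[OF u w], of n i k] by simp
  have "conv b (ssum u) (ssum w) n = (\<Sum>p\<le>n. b (\<Sum>i\<le>n. u i p) (\<Sum>k\<le>n. w k (n - p)))"
    unfolding conv_def by (intro sum.cong refl arg_cong2[where f = b] ssum_eq u w) auto
  also have "\<dots> = (\<Sum>p\<le>n. \<Sum>i\<le>n. \<Sum>k\<le>n. b (u i p) (w k (n - p)))"
    by (simp only: left.sum) (simp only: right.sum)
  also have "\<dots> = (\<Sum>i\<le>n. \<Sum>k\<le>n. conv b (u i) (w k) n)"
    unfolding conv_def by (subst sum.swap, intro sum.cong refl sum.swap)
  also have "\<dots> = (\<Sum>(i, k)\<in>{..n} \<times> {..n}. conv b (u i) (w k) n)"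
    by (simp add: sum.cartesian_product)
  also have "\<dots> = (\<Sum>(i, k)\<in>{(i, k). i + k \<le> n}. conv b (u i) (w k) n)"
    using vanish_conv_n by (intro sum.mono_neutral_right) auto
  also have "\<dots> = ssum (\<lambda>j. \<Sum>i\<le>j. conv b (u i) (w (j - i))) n"
    unfolding ssum_def sum.triangle_reindex_eq by (simp add: sum_fun_apply)
  finally show "conv b (ssum u) (ssum w) n = ssum (\<lambda>j. \<Sum>i\<le>j. conv b (u i) (w (j - i))) n" .
qed

definition euler :: "(nat \<Rightarrow> 'a::rat_vector) \<Rightarrow> nat \<Rightarrow> 'a" where
  "euler v n = of_nat n *\<^sub>Q v n"

lemma additive_euler: "additive euler"
  by standard (simp add: euler_def fun_eq_iff scaleQ_add_right)

lemma euler_ssum: "euler (ssum u) = ssum (\<lambda>j. euler (u j))"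
  by (simp add: euler_def ssum_def fun_eq_iff rat_vector.scale_sum_right)

text \<open>The weights \<open>p\<close> and \<open>n - p\<close> of the two factors add up to
  \<open>n\<close>, so \<theta> is a derivation of every Cauchy product.\<close>

lemma (in biadditive) euler_conv: "euler (conv b x y) = conv b (euler x) y + conv b x (euler y)"
proof
  fix n
  show "euler (conv b x y) n = (conv b (euler x) y + conv b x (euler y)) n"
    unfolding euler_def conv_def plus_fun_apply rat_vector.scale_sum_right sum.distrib[symmetric]
    by (intro sum.cong refl)
      (simp add: scale_left scale_right of_nat_diff flip: scaleQ_add_left)
qed

section \<open>Exponentials of Lie algebra actions\<close>

text \<open>The action of the exponential of \<open>x\<close>. If \<open>x 0 = 0\<close>, the
  \<open>j\<close>-th term has order at least \<open>j\<close>, so the cutoff in \<open>ssum\<close>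
  loses nothing.\<close>

definition expser :: "('a \<Rightarrow> 'v \<Rightarrow> 'v::rat_vector) \<Rightarrow> (nat \<Rightarrow> 'a) \<Rightarrow> (nat \<Rightarrow> 'v) \<Rightarrow> nat \<Rightarrow> 'v" where
  "expser act x v = ssum (\<lambda>j. (1 / fact j) *\<^sub>Q (conv act x ^^ j) v)"

lemma additive_funpow:
  fixes f :: "'a::ab_group_add \<Rightarrow> 'a"
  assumes "additive f" shows "additive (f ^^ j)"
proof (induction j)
  case (Suc j)
  then show ?case
    using assms by (simp add: additive_def)
qed (simp add: additive_def)

text \<open>With the powers divided by factorials, the Leibniz rule below becomes a convolution
  without binomial coefficients.\<close>

lemma divided_power_Suc:
  fixes f :: "'a::rat_vector \<Rightarrow> 'a"
  assumes "additive f"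
  shows "f ((1 / fact j) *\<^sub>Q (f ^^ j) v) = of_nat (Suc j) *\<^sub>Q (1 / fact (Suc j)) *\<^sub>Q (f ^^ Suc j) v"
  by (simp add: additive_scaleQ[OF assms] del: of_nat_Suc)

context biadditive
begin

interpretation conv: biadditive "conv b"
  by (rule biadditive_conv)

lemma additive_conv: "additive (conv b x)"
  by (rule conv.right.additive_axioms)

end

text \<open>Applying the derivation once more raises one of the two indices; the weights
  \<open>i\<close> and \<open>Suc j - i\<close> that arise add up to \<open>Suc j\<close>, which is
  cancelled at the end.\<close>

lemma divided_power_leibniz:
  fixes B :: "'p::rat_vector \<Rightarrow> 'q::rat_vector \<Rightarrow> 'r::rat_vector"
  assumes B: "biadditive B" and D: "additive D1" "additive D2" "additive D3"
    and leibniz: "\<And>p q. D3 (B p q) = B (D1 p) q + B p (D2 q)"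
  shows "(1 / fact j) *\<^sub>Q (D3 ^^ j) (B p q) =
    (\<Sum>i\<le>j. B ((1 / fact i) *\<^sub>Q (D1 ^^ i) p) ((1 / fact (j - i)) *\<^sub>Q (D2 ^^ (j - i)) q))"
proof (induction j)
  case (Suc j)
  interpret biadditive B by fact
  interpret D3: additive D3 by fact
  let ?P = "\<lambda>i. (1 / fact i) *\<^sub>Q (D1 ^^ i) p"
  let ?Q = "\<lambda>i. (1 / fact i) *\<^sub>Q (D2 ^^ i) q"
  let ?R = "\<lambda>i. (1 / fact i) *\<^sub>Q (D3 ^^ i) (B p q)"
  have "of_nat (Suc j) *\<^sub>Q ?R (Suc j) = D3 (\<Sum>i\<le>j. B (?P i) (?Q (j - i)))"
    by (simp only: divided_power_Suc[OF D(3), symmetric] Suc)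
  also have "\<dots> = (\<Sum>i\<le>j. of_nat (Suc i) *\<^sub>Q B (?P (Suc i)) (?Q (Suc j - Suc i)))
      + (\<Sum>i\<le>j. of_nat (Suc j - i) *\<^sub>Q B (?P i) (?Q (Suc j - i)))"
    unfolding D3.sum leibniz divided_power_Suc[OF D(1)] divided_power_Suc[OF D(2)] sum.distrib
    by (intro arg_cong2[where f = plus] sum.cong refl)
      (simp_all add: scale_left scale_right Suc_diff_le del: of_nat_Suc fact_Suc funpow.simps)
  \<comment> \<open>Both ranges extend to \<open>Suc j\<close>: the new terms, at 0 in the first sum
    and at \<open>Suc j\<close> in the second, have weight zero.\<close>
  also have "\<dots> = (\<Sum>i\<le>Suc j. of_nat i *\<^sub>Q B (?P i) (?Q (Suc j - i)))
      + (\<Sum>i\<le>Suc j. of_nat (Suc j - i) *\<^sub>Q B (?P i) (?Q (Suc j - i)))"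
    by (subst sum.atMost_Suc_shift[of "\<lambda>i. of_nat i *\<^sub>Q _ i"])
      (simp del: of_nat_Suc fact_Suc funpow.simps)
  also have "\<dots> = of_nat (Suc j) *\<^sub>Q (\<Sum>i\<le>Suc j. B (?P i) (?Q (Suc j - i)))"
    unfolding sum.distrib[symmetric] rat_vector.scale_sum_right scaleQ_add_left[symmetric]
    by (intro sum.cong refl) (simp add: of_nat_diff del: fact_Suc funpow.simps)
  finally show ?case
    by (simp only: rat_vector.scale_cancel_left) simp
qed simp

context biadditive
begin

lemma vanish_conv_Suc: "x 0 = 0 \<Longrightarrow> vanish n v \<Longrightarrow> vanish (Suc n) (conv b x v)"
  using vanish_conv[of 1 x n v] by simp

end

lemma vanish_funpow_conv:
  fixes act :: "'a::rat_vector \<Rightarrow> 'v::rat_vector \<Rightarrow> 'v"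
  assumes "biadditive act" "x 0 = 0" "vanish n v"
  shows "vanish (n + j) ((conv act x ^^ j) v)"
  using assms by (induction j) (simp_all add: biadditive.vanish_conv_Suc)

lemma vanish_divided_power:
  fixes act :: "'a::rat_vector \<Rightarrow> 'v::rat_vector \<Rightarrow> 'v"
  assumes "biadditive act" "x 0 = 0"
  shows "vanish j (q *\<^sub>Q (conv act x ^^ j) v)"
  using vanish_funpow_conv[where x = x and n = 0 and v = v, OF assms] by (simp add: vanish_scaleQ)

text \<open>The exponential of a derivation is multiplicative. Three separate actions are allowed
  because the factors and their product may lie in different modules.\<close>

lemma expser_leibniz:
  fixes a1 :: "'a::rat_vector \<Rightarrow> 'p::rat_vector \<Rightarrow> 'p" and a2 :: "'a \<Rightarrow> 'q::rat_vector \<Rightarrow> 'q"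
    and a3 :: "'a \<Rightarrow> 'r::rat_vector \<Rightarrow> 'r"
  assumes act: "biadditive a1" "biadditive a2" "biadditive a3" and B: "biadditive B"
    and x: "x 0 = 0"
    and leibniz: "\<And>x p q. a3 x (B p q) = B (a1 x p) q + B p (a2 x q)"
  shows "expser a3 x (conv B p q) = conv B (expser a1 x p) (expser a2 x q)"
proof -
  \<comment> \<open>In the second term \<open>x\<close> has moved past \<open>p\<close>, so the
    first two summation indices are exchanged.\<close>
  have conv_leibniz: "conv a3 x (conv B p q) = conv B (conv a1 x p) q + conv B p (conv a2 x q)" for p q
    unfolding fun_eq_iff plus_fun_apply biadditive.conv_conv_right[OF act(3)]
      biadditive.conv_conv_left[OF B] biadditive.conv_conv_right[OF B] leibniz trip_add
    by (simp add: trip_swap[of "\<lambda>i j k. B (p i) (a2 (x j) (q k))" for p q])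
  have "expser a3 x (conv B p q) = ssum (\<lambda>j. \<Sum>i\<le>j. conv B
      ((1 / fact i) *\<^sub>Q (conv a1 x ^^ i) p) ((1 / fact (j - i)) *\<^sub>Q (conv a2 x ^^ (j - i)) q))"
    unfolding expser_def
    by (rule arg_cong[where f = ssum], rule ext,
        rule divided_power_leibniz[of "conv B" "conv a1 x" "conv a2 x" "conv a3 x"])
      (intro biadditive.biadditive_conv biadditive.additive_conv B act conv_leibniz)+
  also have "\<dots> = conv B (expser a1 x p) (expser a2 x q)"
    unfolding expser_def
    by (rule biadditive.conv_ssum[OF B, symmetric]; rule vanish_divided_power; fact)
  finally show ?thesis .
qed

lemma expser_additive:
  assumes "biadditive act"
  shows "additive (expser act x)"
proof
  fix v w
  show "expser act x (v + w) = expser act x v + expser act x w"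
    unfolding expser_def ssum_add[symmetric]
    by (simp add: additive.add[OF additive_funpow[OF biadditive.additive_conv[OF assms]]] scaleQ_add_right)
qed

text \<open>Every term but the one at \<open>j = 0\<close> raises the order, so the exponential
  keeps the filtration and fixes leading coefficients.\<close>

lemma expser_vanish:
  fixes act :: "'a::rat_vector \<Rightarrow> 'v::rat_vector \<Rightarrow> 'v"
  assumes "biadditive act" "x 0 = 0" "vanish n v"
  shows "vanish n (expser act x v)" "expser act x v n = v n"
proof -
  have *: "(conv act x ^^ j) v m = 0" if "m < n + j" for m j
    using vanish_funpow_conv[where x = x and n = n and v = v, OF assms, of j] that by (simp add: vanish_def)
  show "vanish n (expser act x v)"
    by (auto simp: vanish_def expser_def ssum_def *)
  have "expser act x v n = (\<Sum>j\<in>{0}. ((1 / fact j) *\<^sub>Q (conv act x ^^ j) v) n)"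
    unfolding expser_def ssum_def by (rule sum.mono_neutral_right) (auto simp: *)
  then show "expser act x v n = v n" by simp
qed

lemma expser_zero [simp]:
  fixes act :: "'a::rat_vector \<Rightarrow> 'v::rat_vector \<Rightarrow> 'v"
  assumes "biadditive act"
  shows "expser act 0 v = v"
proof
  fix n
  have 0: "conv act 0 w = 0" for w
    by (simp add: conv_def fun_eq_iff biadditive.zero_left[OF assms]) 
  have "(conv act 0 ^^ j) v = (if j = 0 then v else 0)" for j
    by (cases j) (simp_all add: 0)
  then have "expser act 0 v = ssum (\<lambda>j. if j = 0 then v else 0)"
    unfolding expser_def by (intro arg_cong[where f = ssum]) (auto simp: fun_eq_iff)
  then show "expser act 0 v n = v n"
    by (simp only: ssum_single)
qed

section \<open>The exponential group of a Lie algebra\<close>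

locale lie_algebra = biadditive br
  for br :: "'a::rat_vector \<Rightarrow> 'a \<Rightarrow> 'a" +
  assumes antisym: "br x y = - br y x"
    and jacobi: "br x (br y z) = br (br x y) z + br y (br x z)"

text \<open>The law of a representation is written in Leibniz form, which makes the action itself an
  invariant pairing in the sense of \<open>expser_leibniz\<close>.\<close>

locale lie_rep = lie_algebra br + act: biadditive act
  for br :: "'a::rat_vector \<Rightarrow> 'a \<Rightarrow> 'a" and act :: "'a \<Rightarrow> 'v::rat_vector \<Rightarrow> 'v" +
  assumes act_act: "act x (act y v) = act (br x y) v + act y (act x v)"

text \<open>The element \<open>\<psi>(x)\<close> of the introduction, where \<open>\<theta>\<close> is \<open>euler\<close>.\<close>

definition logder :: "('a \<Rightarrow> 'a \<Rightarrow> 'a::rat_vector) \<Rightarrow> (nat \<Rightarrow> 'a) \<Rightarrow> nat \<Rightarrow> 'a" where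
  "logder br x = ssum (\<lambda>j. if j = 0 then 0 else (1 / fact j) *\<^sub>Q (conv br x ^^ (j - 1)) (euler x))"

text \<open>The index of \<open>logder\<close> is shifted because \<open>euler x\<close> already has
  order one: with a zero term in front, the \<open>j\<close>-th term has order \<open>j\<close>, as
  \<open>ssum\<close> requires.\<close>

lemma (in lie_rep) vanish_logder_term:
  assumes "x 0 = 0"
  shows "vanish j (if j = 0 then 0 else (1 / fact j) *\<^sub>Q (conv br x ^^ (j - 1)) (euler x))"
  using vanish_funpow_conv[OF biadditive_axioms, where x = x and n = 1 and j = "j - 1" and v = "euler x"] assms
  by (auto simp: vanish_scaleQ euler_def)

text \<open>This is the commutator rule for \<theta> and the exponential. It is proved for each
  divided power \<open>E j\<close> separately and then summed with \<open>conv_ssum\<close>.\<close>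

lemma (in lie_rep) euler_expser:
  assumes x: "x 0 = 0"
  shows "euler (expser act x v) = conv act (logder br x) (expser act x v) + expser act x (euler v)"
proof -
  let ?X = "conv act x"
  define E where "E j v = (1 / fact j) *\<^sub>Q (?X ^^ j) v" for j v
  define U where "U j = (if j = 0 then 0 else (1 / fact j) *\<^sub>Q (conv br x ^^ (j - 1)) (euler x))" for j
  interpret X: additive ?X by (rule act.additive_conv)
  interpret eu: additive "euler :: (nat \<Rightarrow> 'v) \<Rightarrow> _" by (rule additive_euler)
  interpret conv: biadditive "conv act" by (rule act.biadditive_conv)
  have E_Suc: "?X (E j v) = of_nat (Suc j) *\<^sub>Q E (Suc j) v" for j v
    unfolding E_def by (rule divided_power_Suc) (rule X.additive_axioms)
  have U_Suc: "conv br x (U i) = of_nat (Suc i) *\<^sub>Q U (Suc i)" if "i \<noteq> 0" for i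
    using that by (cases i) (simp_all add: U_def additive_scaleQ[OF additive_conv] del: of_nat_Suc)
  have X_conv: "?X (conv act u w) = conv act (conv br x u) w + conv act u (?X w)" for u w
    unfolding fun_eq_iff plus_fun_apply act.conv_conv_right act.conv_conv_left
      act_act[of "x _"] trip_add
    by (simp add: trip_swap[of "\<lambda>i j k. act (u i) (act (x j) (w k))"])
  \<comment> \<open>Moving \<open>?X\<close> past \<open>U i\<close> produces a multiple of
    \<open>U (Suc i)\<close>. This fails at \<open>i = 0\<close>, where \<open>U 0\<close> is zero
    but \<open>U 1\<close> is \<open>euler x\<close>; the conditional summand repairs it.\<close>
  have X_U: "?X (conv act (U i) w) + (if i = 0 then conv act (euler x) w else 0) =
      of_nat (Suc i) *\<^sub>Q conv act (U (Suc i)) w + conv act (U i) (?X w)" for i w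
  proof (cases "i = 0")
    case True
    then show ?thesis by (simp add: U_def conv.zero_left X.zero)
  next
    case False
    then show ?thesis by (simp add: X_conv U_Suc conv.scale_left del: of_nat_Suc)
  qed
  have "euler (E j v) = (\<Sum>i\<le>j. conv act (U i) (E (j - i) v)) + E j (euler v)" for j
  proof (induction j)
    case 0
    have "U 0 = 0" by (simp add: U_def)
    then have "conv act (U 0) v = 0" by (simp only: conv.zero_left)
    then show ?case by (simp add: E_def)
  next
    case (Suc j)
    let ?C = "\<lambda>i k. conv act (U i) (E k v)"
    have "of_nat (Suc j) *\<^sub>Q euler (E (Suc j) v) = euler (?X (E j v))"
      by (simp only: E_Suc additive_scaleQ[OF eu.additive_axioms])
    also have "\<dots> = conv act (euler x) (E j v) + (\<Sum>i\<le>j. ?X (?C i (j - i))) + ?X (E j (euler v))"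
      by (simp only: act.euler_conv Suc X.add X.sum add.assoc)
    \<comment> \<open>The term in which \<theta> hits the outermost \<open>x\<close> is written as
      the \<open>i = 0\<close> entry of a sum, in the form that \<open>X_U\<close> absorbs.\<close>
    also have "conv act (euler x) (E j v) =
        (\<Sum>i\<le>j. if i = 0 then conv act (euler x) (E (j - i) v) else 0)"
      by simp
    also have "\<dots> + (\<Sum>i\<le>j. ?X (?C i (j - i))) =
        (\<Sum>i\<le>j. ?X (?C i (j - i)) + (if i = 0 then conv act (euler x) (E (j - i) v) else 0))"
      by (simp only: sum.distrib add.commute)
    also have "\<dots> = (\<Sum>i\<le>j. of_nat (Suc i) *\<^sub>Q ?C (Suc i) (Suc j - Suc i))
        + (\<Sum>i\<le>j. of_nat (Suc j - i) *\<^sub>Q ?C i (Suc j - i))"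
      unfolding X_U E_Suc sum.distrib
      by (intro arg_cong2[where f = plus] sum.cong refl)
        (simp_all add: conv.scale_right Suc_diff_le del: of_nat_Suc)
    also have "\<dots> = (\<Sum>i\<le>Suc j. of_nat i *\<^sub>Q ?C i (Suc j - i))
        + (\<Sum>i\<le>Suc j. of_nat (Suc j - i) *\<^sub>Q ?C i (Suc j - i))"
      by (subst sum.atMost_Suc_shift[of "\<lambda>i. of_nat i *\<^sub>Q _ i"]) (simp del: of_nat_Suc)
    also have "\<dots> = of_nat (Suc j) *\<^sub>Q (\<Sum>i\<le>Suc j. ?C i (Suc j - i))"
      unfolding sum.distrib[symmetric] rat_vector.scale_sum_right scaleQ_add_left[symmetric]
      by (intro sum.cong refl) (simp add: of_nat_diff)
    also have "\<dots> + ?X (E j (euler v)) =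
        of_nat (Suc j) *\<^sub>Q ((\<Sum>i\<le>Suc j. ?C i (Suc j - i)) + E (Suc j) (euler v))"
      by (simp only: E_Suc scaleQ_add_right)
    finally show ?case
      by (simp only: rat_vector.scale_cancel_left) simp
  qed
  then have "euler (expser act x v) =
      ssum (\<lambda>j. \<Sum>i\<le>j. conv act (U i) (E (j - i) v)) + ssum (\<lambda>j. E j (euler v))"
    by (simp only: expser_def E_def[symmetric] euler_ssum ssum_add)
  also have "ssum (\<lambda>j. \<Sum>i\<le>j. conv act (U i) (E (j - i) v)) =
      conv act (ssum U) (ssum (\<lambda>j. E j v))"
    unfolding U_def E_def
    by (rule act.conv_ssum[symmetric] vanish_logder_term x vanish_divided_power act.biadditive_axioms)+
  finally show ?thesis
    by (simp only: expser_def logder_def E_def U_def[abs_def])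
qed

text \<open>Conjugating the action of \<open>u\<close> by the exponential of \<open>x\<close> gives
  the action of exp(ad x) applied to \<open>u\<close>.\<close>

lemma (in lie_rep) expser_conv:
  assumes "x 0 = 0"
  shows "expser act x (conv act u v) = conv act (expser br x u) (expser act x v)"
  by (rule expser_leibniz biadditive_axioms act.biadditive_axioms assms act_act)+

text \<open>The key is that, away from coefficient \<open>n\<close>, every series is of the form \<open>euler w - n w\<close>.\<close>

lemma operator_eq_zero:
  fixes act :: "'a::rat_vector \<Rightarrow> 'v::rat_vector \<Rightarrow> 'v" and \<Delta> :: "(nat \<Rightarrow> 'v) \<Rightarrow> nat \<Rightarrow> 'v"
  assumes act: "biadditive act" and c: "c 0 = 0" and add: "additive \<Delta>"
    and euler: "\<And>v. euler (\<Delta> v) = conv act c (\<Delta> v) + \<Delta> (euler v)"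
    and vanish: "\<And>n v. vanish n v \<Longrightarrow> \<Delta> v n = 0"
  shows "\<Delta> v = 0"
proof -
  interpret additive \<Delta> by fact
  have "\<forall>v. \<Delta> v n = 0" for n
  proof (induction n rule: less_induct)
    case (less n)
    \<comment> \<open>In coefficient \<open>n\<close> the product with \<open>c\<close> drops out:
      \<open>c 0 = 0\<close> removes the first term and the induction hypothesis all others.\<close>
    have n: "of_nat n *\<^sub>Q \<Delta> w n = \<Delta> (euler w) n" for w
    proof -
      have "conv act c (\<Delta> w) n = 0"
        unfolding conv_def
      proof (intro sum.neutral ballI)
        fix p assume "p \<in> {..n}"
        then have "p = 0 \<or> n - p < n" by auto
        then show "act (c p) (\<Delta> w (n - p)) = 0"
          using c less by (auto simp: biadditive.zero_left[OF act] biadditive.zero_right[OF act])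
      qed
      then show ?thesis
        using fun_cong[OF euler[of w], of n] by (simp add: euler_def)
    qed
    show ?case
    proof
      fix v :: "nat \<Rightarrow> 'v"
      \<comment> \<open>\<open>w\<close> solves \<open>euler w - n w = v\<close> away from
        coefficient \<open>n\<close>. There the division by zero yields 0, and \<open>d\<close>
        carries what is left.\<close>
      define w where "w m = (1 / (of_nat m - of_nat n)) *\<^sub>Q v m" for m
      define d where "d m = (if m = n then v m else 0)" for m
      have "v = (euler w - of_nat n *\<^sub>Q w) + d"
      proof
        fix m
        have "(euler w - of_nat n *\<^sub>Q w) m = (of_nat m - of_nat n) *\<^sub>Q w m"
          by (simp add: euler_def rat_vector.scale_left_diff_distrib)
        then show "v m = ((euler w - of_nat n *\<^sub>Q w) + d) m"
          unfolding plus_fun_apply by (simp add: w_def d_def)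
      qed
      then have "\<Delta> v = \<Delta> (euler w) - of_nat n *\<^sub>Q \<Delta> w + \<Delta> d"
        by (simp only: add diff additive_scaleQ[OF \<open>additive \<Delta>\<close>])
      then have "\<Delta> v n = \<Delta> (euler w) n - of_nat n *\<^sub>Q \<Delta> w n + \<Delta> d n"
        by simp
      moreover have "\<Delta> d n = 0"
        by (rule vanish) (simp add: vanish_def d_def)
      ultimately show "\<Delta> v n = 0"
        by (simp add: n)
    qed
  qed
  then show ?thesis by (simp add: fun_eq_iff)
qed

text \<open>Both sides have the same commutator with \<theta>, namely the action of
  \<open>logder br z\<close> on themselves, and the same effect on leading coefficients;
  \<open>operator_eq_zero\<close> applies to their difference.\<close>

lemma (in lie_rep) expser_expser:
  assumes x: "x 0 = 0" and y: "y 0 = 0" and z: "z 0 = 0"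
    and logder: "logder br z = logder br x + expser br x (logder br y)"
  shows "expser act x (expser act y v) = expser act z v"
proof -
  define \<Delta> where "\<Delta> v = expser act x (expser act y v) - expser act z v" for v
  interpret conv: biadditive "conv act" by (rule act.biadditive_conv)
  interpret eu: additive "euler :: (nat \<Rightarrow> 'v) \<Rightarrow> _" by (rule additive_euler)
  have E: "additive (expser act u)" for u
    by (rule expser_additive) (rule act.biadditive_axioms)
  note E_add = additive.add[OF E]
  have "\<Delta> v = 0"
  proof (rule operator_eq_zero[where act = act and \<Delta> = \<Delta> and c = "logder br z"])
    show "logder br z 0 = 0"
      by (simp add: logder_def ssum_def)
    show "additive \<Delta>"
      by standard (simp add: \<Delta>_def E_add)
    show "\<Delta> v n = 0" if "vanish n v" for n v
      using that x y z by (simp add: \<Delta>_def expser_vanish[OF act.biadditive_axioms])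
    fix v
    \<comment> \<open>\<theta> contributes \<psi>(x) in front and \<psi>(y) between the
      exponentials; moving the latter to the front by \<open>expser_conv\<close> gives exp(ad x)
      \<psi>(y).\<close>
    have "euler (expser act x (expser act y v)) =
        conv act (logder br z) (expser act x (expser act y v)) + expser act x (expser act y (euler v))"
      by (simp only: euler_expser[where x = x, OF x] euler_expser[where x = y, OF y] E_add
        expser_conv[where x = x, OF x] logder
        conv.add_left add.assoc)
    then show "euler (\<Delta> v) = conv act (logder br z) (\<Delta> v) + \<Delta> (euler v)"
      by (simp only: \<Delta>_def eu.diff euler_expser[where x = z, OF z] conv.right.diff add_diff_add)
  qed (rule act.biadditive_axioms)
  then show ?thesis by (simp add: \<Delta>_def)
qed

section \<open>Solving equations between series coefficient by coefficient\<close>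

text \<open>If coefficient \<open>n\<close> of \<open>F f\<close> depends only on the coefficients
  of \<open>f\<close> below \<open>n\<close>, then \<open>f = F f\<close> is a well-founded
  recursion.\<close>

lemma causal_fixpoint:
  fixes F :: "(nat \<Rightarrow> 'a) \<Rightarrow> nat \<Rightarrow> 'a"
  assumes "\<And>f g n. (\<And>m. m < n \<Longrightarrow> f m = g m) \<Longrightarrow> F f n = F g n"
  shows "\<exists>f. f = F f"
proof -
  have "wfrec less_than F = F (wfrec less_than F)"
    by (rule wfrec_fixpoint, simp, unfold adm_wf_def, intro allI impI, rule assms) simp
  then show ?thesis by (rule exI[of _ "wfrec less_than F"])
qed

text \<open>As \<open>x 0 = 0\<close>, the last coefficient of \<open>v\<close> is out of reach once
  \<open>0 < j\<close>. The assumption \<open>top\<close> covers two uses: a fixed \<open>x\<close>,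
  as in \<open>ex_expser_preimage\<close>, and a varying \<open>x\<close> acting on a series without
  constant term, as in \<open>ex_logder\<close>.\<close>

lemma conv_funpow_causal:
  fixes act :: "'a::rat_vector \<Rightarrow> 'v::rat_vector \<Rightarrow> 'v"
  assumes act: "biadditive act" and x: "x 0 = 0" "y 0 = 0"
    and agree: "\<And>m. m < n \<Longrightarrow> x m = y m" "\<And>m. m < n \<Longrightarrow> v m = w m"
    and top: "x n = y n \<or> v 0 = 0 \<and> w 0 = 0" and "0 < j" and "m \<le> n"
  shows "(conv act x ^^ j) v m = (conv act y ^^ j) w m"
  using \<open>0 < j\<close> \<open>m \<le> n\<close>
proof (induction j arbitrary: m)
  case (Suc j)
  have step: "(conv act x ^^ Suc j) v m = (\<Sum>p\<le>m. act (x p) ((conv act x ^^ j) v (m - p)))" for x v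
    by (simp add: conv_def[of act x "(conv act x ^^ j) v"])
  show ?case
    unfolding step
  proof (intro sum.cong refl)
    fix p assume p: "p \<in> {..m}"
    \<comment> \<open>Only \<open>p = m = n\<close> reaches the coefficient \<open>x n\<close>; it
      is paired with a constant coefficient, which is zero unless \<open>x n = y n\<close>.\<close>
    consider "p = 0" | "0 < p" "p < n \<or> x n = y n" | "p = n" "m = n" "0 < p" "v 0 = 0 \<and> w 0 = 0"
      using p top \<open>m \<le> n\<close> by fastforce
    then show "act (x p) ((conv act x ^^ j) v (m - p)) = act (y p) ((conv act y ^^ j) w (m - p))"
    proof cases
      case 2
      then have "x p = y p"
        using agree(1) p \<open>m \<le> n\<close> by (cases "p = n") auto
      moreover have "(conv act x ^^ j) v (m - p) = (conv act y ^^ j) w (m - p)"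
        using Suc 2 agree(2) p by (cases "j = 0") auto
      ultimately show ?thesis by simp
    next
      case 3
      have "(conv act x ^^ j) v 0 = 0" if "x 0 = 0" "v 0 = 0" for x v
        using vanish_funpow_conv[where x = x and n = 1 and v = v and j = j, OF act] that
        by (simp add: vanish_def)
      with 3 x show ?thesis
        by (simp add: biadditive.zero_right[OF act])
    qed (simp add: x biadditive.zero_left[OF act])
  qed
qed simp

lemma (in lie_algebra) ex_logder:
  assumes c: "c 0 = 0"
  shows "\<exists>z. z 0 = 0 \<and> logder br z = c"
proof -
  \<comment> \<open>Cutting \<open>f\<close> off below \<open>n\<close> makes \<open>F\<close>
    causal by construction. \<open>S\<close> starts at 2 because the term at 1 is
    \<open>euler f\<close>, whose coefficient \<open>n\<close> times \<open>f n\<close> is the one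
    that \<open>F\<close> solves for.\<close>
  define t :: "nat \<Rightarrow> (nat \<Rightarrow> 'a) \<Rightarrow> nat \<Rightarrow> 'a"
    where "t n f m = (if 0 < m \<and> m < n then f m else 0)" for n f m
  define S where "S f n = (\<Sum>j = 2..n. (1 / fact j) *\<^sub>Q (conv br f ^^ (j - 1)) (euler f) n)" for f n
  define F where "F f n = (if n = 0 then 0 else (1 / of_nat n) *\<^sub>Q (c n - S (t n f) n))" for f n
  have t_cong: "t n f = t n g" if "\<And>m. m < n \<Longrightarrow> f m = g m" for f g n
    using that by (auto simp: t_def fun_eq_iff)
  have "\<exists>z. z = F z"
    by (rule causal_fixpoint) (simp add: F_def cong: t_cong)
  then obtain z where z: "z = F z" ..
  have z0: "z 0 = 0"
    by (subst z) (simp add: F_def)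
  have "logder br z n = c n" for n
  proof (cases "n = 0")
    case True
    then show ?thesis by (simp add: logder_def ssum_def c)
  next
    case False
    have "S z n = S (t n z) n"
      unfolding S_def
      by (intro sum.cong refl arg_cong[where f = "scaleQ _"] conv_funpow_causal[where n = n])
        (auto simp: biadditive_axioms z0 t_def euler_def)
    moreover have "of_nat n *\<^sub>Q z n = c n - S (t n z) n"
      using False by (subst z) (simp add: F_def)
    moreover have "logder br z n = of_nat n *\<^sub>Q z n + S z n"
    proof -
      have "{..n} = insert 0 (insert 1 {2..n})"
        using False by auto
      then show ?thesis
        by (simp add: logder_def ssum_def S_def euler_def)
    qed
    ultimately show ?thesis by simp
  qed
  then show ?thesis using z0 by auto
qed

text \<open>The exponential is the identity plus terms that raise the order, so \<open>v n\<close>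
  equals \<open>u n\<close> minus an expression in earlier coefficients. This surjectivity is used
  to construct inverses.\<close>

lemma ex_expser_preimage:
  fixes act :: "'a::rat_vector \<Rightarrow> 'v::rat_vector \<Rightarrow> 'v"
  assumes act: "biadditive act" and x: "x 0 = 0"
  shows "\<exists>v. expser act x v = u"
proof -
  define S where "S f n = (\<Sum>j = 1..n. (1 / fact j) *\<^sub>Q (conv act x ^^ j) f n)" for f n
  define F where "F f n = u n - S f n" for f n
  have "\<exists>v. v = F v"
  proof (rule causal_fixpoint)
    fix f g :: "nat \<Rightarrow> 'v" and n
    assume "\<And>m. m < n \<Longrightarrow> f m = g m"
    then have "S f n = S g n"
      unfolding S_def using act x
      by (intro sum.cong refl arg_cong[where f = "scaleQ _"] conv_funpow_causal[where n = n]) auto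
    then show "F f n = F g n" by (simp add: F_def)
  qed
  then obtain v where v: "v = F v" ..
  have "expser act x v n = v n + S v n" for n
  proof -
    have "{..n} = insert 0 {1..n}" by auto
    then show ?thesis by (simp add: expser_def ssum_def S_def)
  qed
  moreover have "v n = u n - S v n" for n
    by (subst v) (simp add: F_def)
  ultimately show ?thesis by (auto simp: fun_eq_iff)
qed

lemma logder_zero [simp]:
  assumes "biadditive br"
  shows "logder br 0 = 0"
proof -
  have "(conv br 0 ^^ j) (euler 0) = 0" for j
    using additive.zero[OF additive_euler[where 'a = 'a]]
      additive.zero[OF additive_funpow[OF biadditive.additive_conv[OF assms, of 0], of j]]
    by simp
  then show ?thesis
    by (auto simp: logder_def ssum_def fun_eq_iff intro!: sum.neutral)
qed

context lie_rep
begin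

lemma ex_expser_mult:
  assumes "x 0 = 0" "y 0 = 0"
  shows "\<exists>z. z 0 = 0 \<and> (\<forall>v. expser act x (expser act y v) = expser act z v)"
proof -
  have "(logder br x + expser br x (logder br y)) 0 = 0"
    by (simp add: logder_def ssum_def expser_def)
  then obtain z where "z 0 = 0" "logder br z = logder br x + expser br x (logder br y)"
    using ex_logder by blast
  then show ?thesis
    using expser_expser assms by blast
qed

text \<open>This is \<open>expser_expser\<close> with \<open>z = 0\<close>: one needs exp(ad x)
  \<psi>(y) = - \<psi>(x), so \<psi>(y) is taken as a preimage under exp(ad x).\<close>

lemma ex_expser_right_inverse:
  assumes "x 0 = 0"
  shows "\<exists>y. y 0 = 0 \<and> (\<forall>v. expser act x (expser act y v) = v)"
proof -
  obtain c where c: "expser br x c = - logder br x"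
    using ex_expser_preimage[where x = x, OF biadditive_axioms assms] by blast
  have "c 0 = 0"
    using fun_cong[OF c, of 0] by (simp add: expser_def logder_def ssum_def)
  then obtain y where y: "y 0 = 0" "logder br y = c"
    using ex_logder by blast
  have "logder br 0 = logder br x + expser br x (logder br y)"
    by (simp add: y c biadditive_axioms)
  then have "expser act x (expser act y v) = expser act 0 v" for v
    using assms y by (intro expser_expser) auto
  then show ?thesis
    using y act.biadditive_axioms by auto
qed

text \<open>The right inverse has a right inverse in turn, which must act as \<open>x\<close> does;
  hence the first one is two-sided.\<close>

lemma ex_expser_inverse:
  assumes "x 0 = 0"
  shows "\<exists>y. y 0 = 0 \<and> (\<forall>v. expser act y (expser act x v) = v)"
  using ex_expser_right_inverse assms by metis

end

section \<open>The gauge action\<close>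

text \<open>The operations are the brackets of degree 0 with degrees 0, 1 and 2, the bracket of degree 1 with
  itself, and the differentials in degrees 0 and 1.\<close>

locale truncated_dgla = lie_algebra br + br1: biadditive br1 + br2: biadditive br2 + sq: biadditive sq +
    d0: additive d0 + d1: additive d1
  for br :: "'a::rat_vector \<Rightarrow> 'a \<Rightarrow> 'a" and br1 :: "'a \<Rightarrow> 'b::rat_vector \<Rightarrow> 'b"
    and br2 :: "'a \<Rightarrow> 'c::rat_vector \<Rightarrow> 'c" and sq :: "'b \<Rightarrow> 'b \<Rightarrow> 'c"
    and d0 :: "'a \<Rightarrow> 'b" and d1 :: "'b \<Rightarrow> 'c" +
  assumes br1_br1: "br1 x (br1 y u) = br1 (br x y) u + br1 y (br1 x u)"
    and br2_sq: "br2 x (sq u v) = sq (br1 x u) v + sq u (br1 x v)"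
    and sq_commute: "sq u v = sq v u"
    and d0_br: "d0 (br x y) = br1 x (d0 y) - br1 y (d0 x)"
    and d1_br1: "d1 (br1 x u) = sq (d0 x) u + br2 x (d1 u)"
    and d1_d0: "d1 (d0 x) = 0"
begin

text \<open>The differential is made inner by adjoining an element \<open>\<delta>\<close> of degree 1 with \<open>[\<delta>, x] = d x\<close>; the
  pair \<open>(c, u)\<close> stands for \<open>c \<delta> + u\<close>. The gauge action is the exponential of the adjoint action on
  \<open>\<delta> + \<xi>\<close>, and \<open>\<xi>\<close> is a Maurer--Cartan element iff \<open>[\<delta> + \<xi>, \<delta> + \<xi>] = 0\<close>.\<close>

definition ext_act :: "'a \<Rightarrow> rat \<times> 'b \<Rightarrow> rat \<times> 'b" where
  "ext_act x p = (0, br1 x (snd p) - fst p *\<^sub>Q d0 x)"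

text \<open>The bracket of two elements of degree 1, extended by [\<delta>, \<delta>] = 0, because d
  squares to zero, and [u, \<delta>] = [\<delta>, u] = d u, because both degrees are odd.\<close>

definition ext_sq :: "rat \<times> 'b \<Rightarrow> rat \<times> 'b \<Rightarrow> 'c" where
  "ext_sq p q = fst p *\<^sub>Q d1 (snd q) + fst q *\<^sub>Q d1 (snd p) + sq (snd p) (snd q)"

definition shift :: "(nat \<Rightarrow> 'b) \<Rightarrow> nat \<Rightarrow> rat \<times> 'b" where
  "shift \<xi> n = (if n = 0 then 1 else 0, \<xi> n)"

definition gauge :: "(nat \<Rightarrow> 'a) \<Rightarrow> (nat \<Rightarrow> 'b) \<Rightarrow> nat \<Rightarrow> 'b" where
  "gauge x \<xi> n = snd (expser ext_act x (shift \<xi>) n)"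

lemmas d1_scale = additive_scaleQ[OF d1.additive_axioms]

lemma biadditive_ext_act: "biadditive ext_act"
  by standard (simp_all add: ext_act_def br1.add_left br1.add_right d0.add
      scaleQ_add_right scaleQ_add_left)

text \<open>On \<open>u\<close> the law is \<open>br1_br1\<close>, and on \<delta> it is the
  derivation property \<open>d0_br\<close>.\<close>

lemma lie_rep_ext_act: "lie_rep br ext_act"
proof (rule lie_rep.intro[OF lie_algebra_axioms biadditive_ext_act], rule lie_rep_axioms.intro)
  show "ext_act x (ext_act y p) = ext_act (br x y) p + ext_act y (ext_act x p)" for x y p
    unfolding ext_act_def fst_conv snd_conv br1.right.diff br1.scale_right br1_br1[of x y "snd p"]
      d0_br rat_vector.scale_right_diff_distrib
    by (simp add: algebra_simps)
qed

lemma biadditive_ext_sq: "biadditive ext_sq"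
  by standard (simp_all add: ext_sq_def sq.add_left sq.add_right d1.add
      scaleQ_add_right scaleQ_add_left)

text \<open>On two elements without \<delta> this is \<open>br2_sq\<close>, on \<delta> and
  \<open>u\<close> it is \<open>d1_br1\<close>, and on \<delta> with itself it is
  \<open>d1_d0\<close>.\<close>

lemma ext_sq_invariant: "br2 x (ext_sq p q) = ext_sq (ext_act x p) q + ext_sq p (ext_act x q)"
  by (simp add: ext_act_def ext_sq_def br2.add_right br2.scale_right br2_sq d1.diff d1_scale d1_br1
      d1_d0 sq.left.diff sq.right.diff sq.scale_left sq.scale_right sq_commute[of _ "d0 x"]
      scaleQ_add_right)

text \<open>The action has no \<delta>-component in its values, so only the term at
  \<open>j = 0\<close> contributes one and the coefficient 1 of \<delta> is preserved.\<close>

lemma expser_shift: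
  assumes "x 0 = 0"
  shows "expser ext_act x (shift \<xi>) = shift (gauge x \<xi>)"
proof -
  have "fst ((conv ext_act x ^^ Suc j) v n) = 0" for j v n
    by (simp add: conv_def[of ext_act x "(conv ext_act x ^^ j) v"] fst_sum ext_act_def)
  then have "fst ((conv ext_act x ^^ j) (shift \<xi>) n) = (if j = 0 \<and> n = 0 then 1 else 0)" for j n
    by (cases j) (simp_all add: shift_def)
  then have "fst (expser ext_act x (shift \<xi>) n) = fst (shift \<xi> n)" for n
    by (simp add: expser_def ssum_def fst_sum scaleQ_rat_def shift_def)
  then show ?thesis
    by (simp add: fun_eq_iff prod_eq_iff) (simp add: shift_def gauge_def)
qed

lemma gauge_zero [simp]: "gauge 0 \<xi> = \<xi>"
  by (simp add: gauge_def fun_eq_iff biadditive_ext_act shift_def)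

lemma gauge_gauge:
  assumes "y 0 = 0"
  shows "gauge x (gauge y \<xi>) n = snd (expser ext_act x (expser ext_act y (shift \<xi>)) n)"
  unfolding expser_shift[where x = y, OF assms] gauge_def[of x] ..

lemma ex_gauge_mult:
  assumes "x 0 = 0" "y 0 = 0"
  shows "\<exists>z. z 0 = 0 \<and> (\<forall>\<xi>. gauge x (gauge y \<xi>) = gauge z \<xi>)"
proof -
  obtain z where z: "z 0 = 0" and mult: "\<And>v. expser ext_act x (expser ext_act y v) = expser ext_act z v"
    using lie_rep.ex_expser_mult[OF lie_rep_ext_act, where x = x and y = y, OF assms] by metis
  have "gauge x (gauge y \<xi>) n = gauge z \<xi> n" for \<xi> n
    by (simp only: gauge_gauge[where y = y, OF assms(2)] mult gauge_def[of z])
  with z show ?thesis by auto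
qed

lemma ex_gauge_inverse:
  assumes "x 0 = 0"
  shows "\<exists>y. y 0 = 0 \<and> (\<forall>\<xi>. gauge y (gauge x \<xi>) = \<xi>)"
proof -
  obtain y where y: "y 0 = 0" and inv: "\<And>v. expser ext_act y (expser ext_act x v) = v"
    using lie_rep.ex_expser_inverse[OF lie_rep_ext_act, where x = x, OF assms] by metis
  have "gauge y (gauge x \<xi>) n = \<xi> n" for \<xi> n
    by (simp only: gauge_gauge[where y = x, OF assms] inv) (simp add: shift_def)
  with y show ?thesis by auto
qed

text \<open>\<delta> occurs only in the constant coefficient, so it meets \<open>\<xi> n\<close>
  exactly twice, at \<open>p = 0\<close> and at \<open>p = n\<close>; the result is twice the
  Maurer-Cartan expression.\<close>

lemma curvature_shift: "conv ext_sq (shift \<xi>) (shift \<xi>) n = 2 *\<^sub>Q d1 (\<xi> n) + conv sq \<xi> \<xi> n"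
proof -
  have "conv ext_sq (shift \<xi>) (shift \<xi>) n =
      (\<Sum>p\<le>n. if p = 0 then d1 (\<xi> n) else 0) + (\<Sum>p\<le>n. if p = n then d1 (\<xi> n) else 0) + conv sq \<xi> \<xi> n"
    unfolding conv_def sum.distrib[symmetric]
    by (intro sum.cong refl) (auto simp: ext_sq_def shift_def)
  also have "\<dots> = 2 *\<^sub>Q d1 (\<xi> n) + conv sq \<xi> \<xi> n"
    using scaleQ_add_left[of 1 1 "d1 (\<xi> n)"] by simp
  finally show ?thesis .
qed

lemma gauge_curvature:
  assumes "x 0 = 0" and "\<And>n. 2 *\<^sub>Q d1 (\<xi> n) + conv sq \<xi> \<xi> n = 0"
  shows "2 *\<^sub>Q d1 (gauge x \<xi> n) + conv sq (gauge x \<xi>) (gauge x \<xi>) n = 0"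
proof -
  have "conv ext_sq (shift \<xi>) (shift \<xi>) = 0"
    using assms by (simp add: fun_eq_iff curvature_shift)
  then have "0 = expser br2 x (conv ext_sq (shift \<xi>) (shift \<xi>))"
    using additive.zero[OF expser_additive[OF br2.biadditive_axioms]] by simp
  also have "\<dots> = conv ext_sq (shift (gauge x \<xi>)) (shift (gauge x \<xi>))"
    unfolding expser_shift[where x = x, OF assms(1), symmetric]
    by (rule expser_leibniz biadditive_ext_act biadditive_ext_sq br2.biadditive_axioms
        ext_sq_invariant assms)+
  finally show ?thesis
    by (simp add: fun_eq_iff curvature_shift)
qed

text \<open>This recovers the explicit series of the gauge action. One step sends \<delta> + \<xi>
  to [x, \<xi>] - d x, which has no \<delta>-component; later steps are plain adjoint actions, so
  the powers on \<open>d x\<close> lag one behind and carry the factorial of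
  \<open>1 + j\<close>.\<close>

lemma gauge_eq:
  assumes x: "x 0 = 0"
  shows "gauge x \<xi> m = (\<Sum>j\<le>m. (1 / fact j) *\<^sub>Q (conv br1 x ^^ j) \<xi> m)
    - (\<Sum>j\<le>m. (1 / fact (1 + j)) *\<^sub>Q (conv br1 x ^^ j) (\<lambda>n. d0 (x n)) m)"
proof -
  let ?dx = "\<lambda>n. d0 (x n)"
  interpret conv: biadditive "conv br1" by (rule br1.biadditive_conv)
  have step: "snd (conv ext_act x v n) = conv br1 x (\<lambda>n. snd (v n)) n
      - (\<Sum>p\<le>n. fst (v (n - p)) *\<^sub>Q d0 (x p))" for v n
    by (simp add: conv_def ext_act_def snd_sum sum_subtractf)
  have fst0: "fst ((conv ext_act x ^^ Suc j) v n) = 0" for j v n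
    by (simp add: conv_def[of ext_act x "(conv ext_act x ^^ j) v"] fst_sum ext_act_def)
  have pow: "(\<lambda>n. snd ((conv ext_act x ^^ Suc j) (shift \<xi>) n)) =
      (conv br1 x ^^ Suc j) \<xi> - (conv br1 x ^^ j) ?dx" for j
  proof (induction j)
    case 0
    have "(\<Sum>p\<le>n. fst (shift \<xi> (n - p)) *\<^sub>Q d0 (x p)) = (\<Sum>p\<le>n. if p = n then d0 (x n) else 0)" for n
      by (intro sum.cong refl) (auto simp: shift_def)
    then show ?case
      by (simp add: step fun_eq_iff) (simp add: shift_def)
  next
    case (Suc j)
    have "(\<lambda>n. snd ((conv ext_act x ^^ Suc (Suc j)) (shift \<xi>) n)) =
        conv br1 x (\<lambda>n. snd ((conv ext_act x ^^ Suc j) (shift \<xi>) n))"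
      using step[of "(conv ext_act x ^^ Suc j) (shift \<xi>)"] by (simp only: fst0) simp
    also have "\<dots> = conv br1 x ((conv br1 x ^^ Suc j) \<xi> - (conv br1 x ^^ j) ?dx)"
      by (simp only: Suc.IH)
    finally show ?case
      by (simp only: conv.right.diff funpow.simps comp_def)
  qed
  have "gauge x \<xi> m = (\<Sum>j\<le>m. (1 / fact j) *\<^sub>Q snd ((conv ext_act x ^^ j) (shift \<xi>) m))"
    by (simp add: gauge_def expser_def ssum_def snd_sum)
  also have "\<dots> = (\<Sum>j\<le>m. (1 / fact j) *\<^sub>Q (conv br1 x ^^ j) \<xi> m
      - (if j = 0 then 0 else (1 / fact j) *\<^sub>Q (conv br1 x ^^ (j - 1)) ?dx m))"
  proof (intro sum.cong refl)
    fix j show "(1 / fact j) *\<^sub>Q snd ((conv ext_act x ^^ j) (shift \<xi>) m) =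
      (1 / fact j) *\<^sub>Q (conv br1 x ^^ j) \<xi> m
      - (if j = 0 then 0 else (1 / fact j) *\<^sub>Q (conv br1 x ^^ (j - 1)) ?dx m)"
    proof (cases j)
      case (Suc i)
      then show ?thesis
        using fun_cong[OF pow[of i], of m]
        by (simp add: rat_vector.scale_right_diff_distrib del: funpow.simps fact_Suc)
    qed (simp add: shift_def)
  qed
  also have "\<dots> = (\<Sum>j\<le>m. (1 / fact j) *\<^sub>Q (conv br1 x ^^ j) \<xi> m)
      - (\<Sum>j\<le>m. if j = 0 then 0 else (1 / fact j) *\<^sub>Q (conv br1 x ^^ (j - 1)) ?dx m)"
    by (simp only: sum_subtractf)
  also have "(\<Sum>j\<le>m. if j = 0 then 0 else (1 / fact j) *\<^sub>Q (conv br1 x ^^ (j - 1)) ?dx m) =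
      (\<Sum>j<m. (1 / fact (1 + j)) *\<^sub>Q (conv br1 x ^^ j) ?dx m)"
    by (simp add: sum.atMost_shift)
  \<comment> \<open>The term at \<open>j = m\<close> may be added: \<open>d x\<close> has order one,
    so its \<open>m\<close>-th adjoint power has order \<open>m + 1\<close>.\<close>
  also have "(\<Sum>j<m. (1 / fact (1 + j)) *\<^sub>Q (conv br1 x ^^ j) ?dx m) =
      (\<Sum>j\<le>m. (1 / fact (1 + j)) *\<^sub>Q (conv br1 x ^^ j) ?dx m)"
    using vanish_funpow_conv[where x = x and n = 1 and v = ?dx and j = m, OF br1.biadditive_axioms x]
    by (simp add: vanish_def x d0.zero flip: lessThan_Suc_atMost)
  finally show ?thesis .
qed

end

section \<open>Modules over rational scalars as rational vector spaces\<close>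

lemma rat_embed_hom:
  assumes "contains_rationals R"
  shows "rat_embed R \<in> ring_hom (ring_of_type_algebra :: rat ring) R"
  using assms unfolding contains_rationals_def rat_embed_def by (metis someI)

locale rat_module = module R M for R (structure) and M (structure) +
  assumes rationals: "contains_rationals R"
begin

abbreviation qsmult :: "rat \<Rightarrow> 'c \<Rightarrow> 'c" (infixr \<open>\<cdot>\<close> 75) where
  "q \<cdot> x \<equiv> rat_embed R q \<odot>\<^bsub>M\<^esub> x"

lemma rat_embed_simps [simp]:
  "rat_embed R q \<in> carrier R" "rat_embed R 1 = \<one>"
  "rat_embed R (p + q) = rat_embed R p \<oplus> rat_embed R q"
  "rat_embed R (p * q) = rat_embed R p \<otimes> rat_embed R q"
  using rat_embed_hom[OF rationals] by (auto simp: ring_hom_def ring_of_type_algebra_def)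

lemma rat_embed_0 [simp]: "rat_embed R 0 = \<zero>"
  using rat_embed_simps(3)[of 0 0] by (metis R.add.l_cancel_one add_0 rat_embed_simps(1))

text \<open>Formal combinations of all elements of the type are evaluated in the module; elements
  outside the carrier count as zero, which makes the map linear on the whole function type.\<close>

definition lincomb :: "('c \<Rightarrow>\<^sub>0 rat) \<Rightarrow> 'c" where
  "lincomb f = (\<Oplus>\<^bsub>M\<^esub>a\<in>Poly_Mapping.keys f.
     poly_mapping.lookup f a \<cdot> (if a \<in> carrier M then a else \<zero>\<^bsub>M\<^esub>))"

lemma lincomb_closed [simp]: "lincomb f \<in> carrier M"
  by (auto simp: lincomb_def intro!: M.finsum_closed)

lemma lincomb_superset:
  assumes "finite S" "Poly_Mapping.keys f \<subseteq> S"
  shows "lincomb f = (\<Oplus>\<^bsub>M\<^esub>a\<in>S. poly_mapping.lookup f a \<cdot> (if a \<in> carrier M then a else \<zero>\<^bsub>M\<^esub>))"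
  unfolding lincomb_def using assms
  by (intro M.add.finprod_mono_neutral_cong_left) (auto simp: in_keys_iff)

lemma lincomb_add: "lincomb (f + g) = lincomb f \<oplus>\<^bsub>M\<^esub> lincomb g"
proof -
  let ?S = "Poly_Mapping.keys f \<union> Poly_Mapping.keys g"
  have "lincomb h = (\<Oplus>\<^bsub>M\<^esub>a\<in>?S. poly_mapping.lookup h a \<cdot> (if a \<in> carrier M then a else \<zero>\<^bsub>M\<^esub>))"
    if "h = f \<or> h = g \<or> h = f + g" for h
    using that keys_add[of f g] by (intro lincomb_superset) auto
  then show ?thesis
    by (auto simp: lookup_add smult_l_distr Pi_iff simp flip: M.finsum_addf intro!: M.finsum_cong')
qed

lemma lincomb_scaleQ: "lincomb (q *\<^sub>Q f) = q \<cdot> lincomb f"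
proof -
  have "Poly_Mapping.keys (q *\<^sub>Q f) \<subseteq> Poly_Mapping.keys f"
    by (auto simp: in_keys_iff scaleQ_rat_def)
  then have "lincomb (q *\<^sub>Q f) = (\<Oplus>\<^bsub>M\<^esub>a\<in>Poly_Mapping.keys f.
      q \<cdot> poly_mapping.lookup f a \<cdot> (if a \<in> carrier M then a else \<zero>\<^bsub>M\<^esub>))"
    by (subst lincomb_superset[of "Poly_Mapping.keys f"])
      (auto simp: scaleQ_rat_def smult_assoc1 intro!: M.finsum_cong')
  also have "\<dots> = q \<cdot> lincomb f"
    unfolding lincomb_def by (intro finsum_smult_ldistr[symmetric]) auto
  finally show ?thesis .
qed

lemma lincomb_single: "x \<in> carrier M \<Longrightarrow> lincomb (Poly_Mapping.single x 1) = x"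
  by (simp add: lincomb_def)

lemma lincomb_diff: "lincomb (f - g) = lincomb f \<ominus>\<^bsub>M\<^esub> lincomb g"
proof -
  have "lincomb (f - g) \<oplus>\<^bsub>M\<^esub> lincomb g = lincomb f"
    by (simp flip: lincomb_add)
  then show ?thesis
    by (metis M.add.inv_solve_right' lincomb_closed a_minus_def)
qed

text \<open>The kernel of \<open>lincomb\<close> has a complement, so that \<open>lincomb\<close> has a linear section.\<close>

lemma ex_section:
  "\<exists>\<sigma>. (\<forall>x\<in>carrier M. lincomb (\<sigma> x) = x) \<and>
    (\<forall>x\<in>carrier M. \<forall>y\<in>carrier M. \<sigma> (x \<oplus>\<^bsub>M\<^esub> y) = \<sigma> x + \<sigma> y) \<and>
    (\<forall>q. \<forall>x\<in>carrier M. \<sigma> (q \<cdot> x) = q *\<^sub>Q \<sigma> x)"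
proof -
  interpret pair: vector_space_pair "scaleQ :: rat \<Rightarrow> ('c \<Rightarrow>\<^sub>0 rat) \<Rightarrow> _" "scaleQ :: rat \<Rightarrow> ('c \<Rightarrow>\<^sub>0 rat) \<Rightarrow> _"
    by unfold_locales
  define K where "K = {f. lincomb f = \<zero>\<^bsub>M\<^esub>}"
  have K: "rat_vector.subspace K"
    unfolding K_def
    by (rule rat_vector.subspaceI)
      (auto simp: lincomb_add lincomb_scaleQ lincomb_def[of 0])
  obtain B where B: "B \<subseteq> K" "rat_vector.independent B" "K \<subseteq> rat_vector.span B"
    using rat_vector.maximal_independent_subset[of K] by blast
  define C where "C = rat_vector.extend_basis B"
  have C: "B \<subseteq> C" "rat_vector.independent C" "rat_vector.span C = UNIV"
    using rat_vector.extend_basis_superset[OF B(2)] rat_vector.independent_extend_basis[OF B(2)]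
      rat_vector.span_extend_basis[OF B(2)] by (auto simp: C_def)
  \<comment> \<open>\<pi> projects along the kernel \<open>K\<close>: it kills a basis of
    \<open>K\<close> and fixes the vectors that complete it to a basis of the whole space.\<close>
  obtain \<pi> where \<pi>: "Vector_Spaces.linear scaleQ scaleQ \<pi>" and \<pi>_C: "\<And>f. f \<in> C \<Longrightarrow> \<pi> f = (if f \<in> B then 0 else f)"
    using pair.linear_independent_extend[OF C(2), of "\<lambda>f. if f \<in> B then 0 else f"] by blast
  interpret \<pi>: Vector_Spaces.linear scaleQ scaleQ \<pi> by (rule \<pi>)
  have \<pi>_K: "\<pi> f = 0" if "f \<in> K" for f
  proof -
    have "f \<in> rat_vector.span B" using that B by blast
    moreover have "\<pi> g = 0" if "g \<in> B" for g
      using that \<pi>_C C(1) by auto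
    ultimately show ?thesis
      by (rule \<pi>.eq_0_on_span[rotated])
  qed
  have "rat_vector.subspace {f. f - \<pi> f \<in> K}"
  proof (rule rat_vector.subspaceI)
    show "0 \<in> {f. f - \<pi> f \<in> K}"
      using rat_vector.subspace_0[OF K] by (simp add: \<pi>.zero)
    show "f + g \<in> {f. f - \<pi> f \<in> K}" if "f \<in> {f. f - \<pi> f \<in> K}" "g \<in> {f. f - \<pi> f \<in> K}" for f g
      using rat_vector.subspace_add[OF K, of "f - \<pi> f" "g - \<pi> g"] that
      by (simp add: \<pi>.add algebra_simps)
    show "q *\<^sub>Q f \<in> {f. f - \<pi> f \<in> K}" if "f \<in> {f. f - \<pi> f \<in> K}" for q f
      using rat_vector.subspace_scale[OF K, of "f - \<pi> f" q] that
      by (simp add: \<pi>.scale rat_vector.scale_right_diff_distrib)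
  qed
  moreover have "f - \<pi> f \<in> K" if "f \<in> C" for f
    using that B(1) \<pi>_C rat_vector.subspace_0[OF K] by auto
  ultimately have "f - \<pi> f \<in> K" for f
    using rat_vector.span_induct[of f C "\<lambda>f. f - \<pi> f \<in> K"] C(3) by simp
  then have lincomb_\<pi>: "lincomb (\<pi> f) = lincomb f" for f
    using lincomb_add[of "f - \<pi> f" "\<pi> f"] by (simp add: K_def)
  \<comment> \<open>The formal symbol of a sum differs from the sum of the symbols by an element of
    \<open>K\<close>, which \<pi> kills; likewise for scalar multiples.\<close>
  define \<sigma> where "\<sigma> x = \<pi> (Poly_Mapping.single x 1)" for x
  have "\<sigma> (x \<oplus>\<^bsub>M\<^esub> y) = \<sigma> x + \<sigma> y" if "x \<in> carrier M" "y \<in> carrier M" for x y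
  proof -
    have "\<pi> (Poly_Mapping.single (x \<oplus>\<^bsub>M\<^esub> y) 1 - (Poly_Mapping.single x 1 + Poly_Mapping.single y 1)) = 0"
      using that by (intro \<pi>_K) (simp add: K_def lincomb_diff lincomb_add lincomb_single M.r_neg M.minus_eq)
    then show ?thesis
      by (simp add: \<sigma>_def \<pi>.diff \<pi>.add)
  qed
  moreover have "\<sigma> (q \<cdot> x) = q *\<^sub>Q \<sigma> x" if "x \<in> carrier M" for q x
  proof -
    have "\<pi> (Poly_Mapping.single (q \<cdot> x) 1 - q *\<^sub>Q Poly_Mapping.single x 1) = 0"
      using that by (intro \<pi>_K) (simp add: K_def lincomb_diff lincomb_scaleQ lincomb_single M.r_neg M.minus_eq)
    then show ?thesis
      by (simp add: \<sigma>_def \<pi>.diff \<pi>.scale)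
  qed
  ultimately show ?thesis
    by (intro exI[of _ \<sigma>]) (auto simp: \<sigma>_def lincomb_\<pi> lincomb_single)
qed

definition emb :: "'c \<Rightarrow> 'c \<Rightarrow>\<^sub>0 rat" where
  "emb = (SOME \<sigma>. (\<forall>x\<in>carrier M. lincomb (\<sigma> x) = x) \<and>
    (\<forall>x\<in>carrier M. \<forall>y\<in>carrier M. \<sigma> (x \<oplus>\<^bsub>M\<^esub> y) = \<sigma> x + \<sigma> y) \<and>
    (\<forall>q. \<forall>x\<in>carrier M. \<sigma> (q \<cdot> x) = q *\<^sub>Q \<sigma> x))"

lemma
  assumes "x \<in> carrier M"
  shows lincomb_emb [simp]: "lincomb (emb x) = x"
    and emb_add: "y \<in> carrier M \<Longrightarrow> emb (x \<oplus>\<^bsub>M\<^esub> y) = emb x + emb y"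
    and emb_qsmult: "emb (q \<cdot> x) = q *\<^sub>Q emb x"
  using someI_ex[OF ex_section] assms unfolding emb_def[symmetric] by blast+

lemma emb_inject: "x \<in> carrier M \<Longrightarrow> y \<in> carrier M \<Longrightarrow> emb x = emb y \<longleftrightarrow> x = y"
  by (metis lincomb_emb)

lemma emb_zero [simp]: "emb \<zero>\<^bsub>M\<^esub> = 0"
  using emb_add[of "\<zero>\<^bsub>M\<^esub>" "\<zero>\<^bsub>M\<^esub>"] by simp

lemma lincomb_zero [simp]: "lincomb 0 = \<zero>\<^bsub>M\<^esub>"
  by (simp add: lincomb_def)

lemma emb_uminus: "x \<in> carrier M \<Longrightarrow> emb (\<ominus>\<^bsub>M\<^esub> x) = - emb x"
  using emb_add[of x "\<ominus>\<^bsub>M\<^esub> x"] by (simp add: M.r_neg eq_neg_iff_add_eq_0 add.commute)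

lemma emb_minus: "x \<in> carrier M \<Longrightarrow> y \<in> carrier M \<Longrightarrow> emb (x \<ominus>\<^bsub>M\<^esub> y) = emb x - emb y"
  by (simp add: M.minus_eq emb_add emb_uminus)

lemma emb_finsum:
  assumes "f \<in> A \<rightarrow> carrier M"
  shows "emb (\<Oplus>\<^bsub>M\<^esub>a\<in>A. f a) = (\<Sum>a\<in>A. emb (f a))"
  using assms by (induction A rule: infinite_finite_induct) (auto simp: emb_add Pi_iff)

end

section \<open>The gauge action on Maurer--Cartan elements\<close>

lemma (in dgla) bracket_closed [simp]:
  "x \<in> carrier (Deg L i) \<Longrightarrow> y \<in> carrier (Deg L j) \<Longrightarrow> Bracket L i j x y \<in> carrier (Deg L (i + j))"
  using bracket_linear_left[of y j i] by (auto simp: linear_maps_def)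

lemma (in dgla) diff_closed [simp]: "x \<in> carrier (Deg L i) \<Longrightarrow> Diff L i x \<in> carrier (Deg L (i + 1))"
  using diff_linear[of i] by (auto simp: linear_maps_def)

locale rat_dgla = dgla R L for R (structure) and L :: "('r, 'a) dgla" +
  assumes rationals: "contains_rationals R"
begin

lemma rat_module_Deg: "rat_module R (Deg L i)"
  by (simp add: rat_module_def rat_module_axioms_def module_Deg rationals)

sublocale Deg: rat_module R "Deg L i" for i
  by (rule rat_module_Deg)

abbreviation E :: "int \<Rightarrow> 'a \<Rightarrow> 'a \<Rightarrow>\<^sub>0 rat" where "E i \<equiv> rat_module.emb R (Deg L i)"
abbreviation V :: "int \<Rightarrow> ('a \<Rightarrow>\<^sub>0 rat) \<Rightarrow> 'a" where "V i \<equiv> rat_module.lincomb R (Deg L i)"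

text \<open>The arguments are evaluated first and the result is embedded again, so that biadditivity
  holds on the whole type.\<close>

definition lbr :: "int \<Rightarrow> int \<Rightarrow> ('a \<Rightarrow>\<^sub>0 rat) \<Rightarrow> ('a \<Rightarrow>\<^sub>0 rat) \<Rightarrow> 'a \<Rightarrow>\<^sub>0 rat" where
  "lbr i j f g = E (i + j) (Bracket L i j (V i f) (V j g))"

definition ldiff :: "int \<Rightarrow> ('a \<Rightarrow>\<^sub>0 rat) \<Rightarrow> 'a \<Rightarrow>\<^sub>0 rat" where
  "ldiff i f = E (i + 1) (Diff L i (V i f))"

lemma bracket_closed':
  "x \<in> carrier (Deg L i) \<Longrightarrow> y \<in> carrier (Deg L j) \<Longrightarrow> i + j = k \<Longrightarrow>
    Bracket L i j x y \<in> carrier (Deg L k)"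
  using bracket_closed by blast

lemma biadditive_lbr: "biadditive (lbr i j)"
proof
  fix f f' g
  show "lbr i j (f + f') g = lbr i j f g + lbr i j f' g"
    using bracket_linear_left[of "V j g" j i]
    by (simp add: lbr_def Deg.lincomb_add linear_maps_def Deg.emb_add)
next
  fix f g g'
  show "lbr i j f (g + g') = lbr i j f g + lbr i j f g'"
    using bracket_linear_right[of "V i f" i j]
    by (simp add: lbr_def Deg.lincomb_add linear_maps_def Deg.emb_add)
qed

lemma additive_ldiff: "additive (ldiff i)"
proof
  fix f g show "ldiff i (f + g) = ldiff i f + ldiff i g"
    using diff_linear[of i] by (simp add: ldiff_def Deg.lincomb_add linear_maps_def Deg.emb_add Pi_iff)
qed

lemma lbr_emb: "x \<in> carrier (Deg L i) \<Longrightarrow> y \<in> carrier (Deg L j) \<Longrightarrow>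
    lbr i j (E i x) (E j y) = E (i + j) (Bracket L i j x y)"
  by (simp add: lbr_def)

lemma ldiff_emb: "x \<in> carrier (Deg L i) \<Longrightarrow> ldiff i (E i x) = E (i + 1) (Diff L i x)"
  by (simp add: ldiff_def)

sublocale T: truncated_dgla "lbr 0 0" "lbr 0 1" "lbr 0 2" "lbr 1 1" "ldiff 0" "ldiff 1"
proof (intro truncated_dgla.intro lie_algebra.intro biadditive_lbr additive_ldiff
    lie_algebra_axioms.intro truncated_dgla_axioms.intro)
  have E01: "x \<in> carrier (Deg L 0) \<Longrightarrow> y \<in> carrier (Deg L 1) \<Longrightarrow> Bracket L 0 1 x y \<in> carrier (Deg L 1)"
    and E00: "x \<in> carrier (Deg L 0) \<Longrightarrow> y \<in> carrier (Deg L 0) \<Longrightarrow> Bracket L 0 0 x y \<in> carrier (Deg L 0)"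
    and E10: "x \<in> carrier (Deg L 1) \<Longrightarrow> y \<in> carrier (Deg L 0) \<Longrightarrow> Bracket L 1 0 x y \<in> carrier (Deg L 1)"
    and E02: "x \<in> carrier (Deg L 0) \<Longrightarrow> y \<in> carrier (Deg L 2) \<Longrightarrow> Bracket L 0 2 x y \<in> carrier (Deg L 2)"
    and E11: "x \<in> carrier (Deg L 1) \<Longrightarrow> y \<in> carrier (Deg L 1) \<Longrightarrow> Bracket L 1 1 x y \<in> carrier (Deg L 2)"
 for x y
    by (simp_all add: bracket_closed')
  have D0: "x \<in> carrier (Deg L 0) \<Longrightarrow> Diff L 0 x \<in> carrier (Deg L 1)"
    and D1: "x \<in> carrier (Deg L 1) \<Longrightarrow> Diff L 1 x \<in> carrier (Deg L 2)" for x
    using diff_closed[of x 0] diff_closed[of x 1] by simp_all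
  note closed = E01 E00 E10 E02 E11 D0 D1
  fix x y z
  let ?x = "V 0 x" and ?y = "V 0 y"
  show "lbr 0 0 x y = - lbr 0 0 y x"
    using bracket_antisym[of ?x 0 ?y 0] by (simp add: lbr_def signed_def Deg.emb_uminus closed)
  show "lbr 0 0 x (lbr 0 0 y z) = lbr 0 0 (lbr 0 0 x y) z + lbr 0 0 y (lbr 0 0 x z)"
    using jacobi[of ?x 0 ?y 0 "V 0 z" 0] by (simp add: lbr_def signed_def Deg.emb_add closed)
  \<comment> \<open>The Leibniz rule yields the bracket of \<open>d x\<close> with \<open>y\<close>;
    antisymmetry between degrees 1 and 0 turns it into minus the bracket of \<open>y\<close> with
    \<open>d x\<close>.\<close>
  show "ldiff 0 (lbr 0 0 x y) = lbr 0 1 x (ldiff 0 y) - lbr 0 1 y (ldiff 0 x)"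
    using diff_bracket[of ?x 0 ?y 0] bracket_antisym[of "Diff L 0 ?x" 1 ?y 0]
    by (simp add: lbr_def ldiff_def signed_def Deg.emb_add Deg.emb_uminus closed)
  show "ldiff 1 (ldiff 0 x) = 0"
    using diff_diff[of ?x 0] by (simp add: ldiff_def closed)
  fix u v
  let ?u = "V 1 u" and ?v = "V 1 v"
  show "lbr 0 1 x (lbr 0 1 y u) = lbr 0 1 (lbr 0 0 x y) u + lbr 0 1 y (lbr 0 1 x u)"
    using jacobi[of ?x 0 ?y 0 ?u 1] by (simp add: lbr_def signed_def Deg.emb_add closed)
  show "lbr 0 2 x (lbr 1 1 u v) = lbr 1 1 (lbr 0 1 x u) v + lbr 1 1 u (lbr 0 1 x v)"
    using jacobi[of ?x 0 ?u 1 ?v 1] by (simp add: lbr_def signed_def Deg.emb_add closed)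
  \<comment> \<open>In degrees 1 and 1 the two signs of graded antisymmetry cancel.\<close>
  show "lbr 1 1 u v = lbr 1 1 v u"
    using bracket_antisym[of ?u 1 ?v 1] by (simp add: lbr_def signed_def Deg.emb_uminus closed)
  show "ldiff 1 (lbr 0 1 x u) = lbr 1 1 (ldiff 0 x) u + lbr 0 2 x (ldiff 1 u)"
    using diff_bracket[of ?x 0 ?u 1]
    by (simp add: lbr_def ldiff_def signed_def Deg.emb_add closed)
qed

abbreviation lift :: "int \<Rightarrow> (nat \<Rightarrow> 'a) \<Rightarrow> nat \<Rightarrow> 'a \<Rightarrow>\<^sub>0 rat" where
  "lift i f \<equiv> \<lambda>n. E i (f n)"

lemma formal_carrier: "f \<in> carrier (Deg (formal L) i) \<longleftrightarrow> f 0 = \<zero>\<^bsub>Deg L i\<^esub> \<and> (\<forall>n. f n \<in> carrier (Deg L i))"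
  by (simp add: formal_def formal_module_def)

lemma formal_bracket_closed:
  assumes "\<And>n. f n \<in> carrier (Deg L i)" "\<And>n. g n \<in> carrier (Deg L j)" "i + j = k"
  shows "Bracket (formal L) i j f g n \<in> carrier (Deg L k)"
  using assms by (auto simp: formal_def intro!: Deg.M.finsum_closed)

lemma emb_formal_bracket:
  assumes "\<And>n. f n \<in> carrier (Deg L i)" "\<And>n. g n \<in> carrier (Deg L j)" "i + j = k"
  shows "E k (Bracket (formal L) i j f g n) = conv (lbr i j) (lift i f) (lift j g) n"
  using assms by (auto simp: formal_def conv_def lbr_emb Deg.emb_finsum)

lemma formal_ad:
  assumes "\<And>n. x n \<in> carrier (Deg L 0)" "\<And>n. f n \<in> carrier (Deg L 1)"
  shows "(Bracket (formal L) 0 1 x ^^ j) f n \<in> carrier (Deg L 1)"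
    and "E 1 ((Bracket (formal L) 0 1 x ^^ j) f n) = (conv (lbr 0 1) (lift 0 x) ^^ j) (lift 1 f) n"
proof -
  have *: "(\<forall>n. (Bracket (formal L) 0 1 x ^^ j) f n \<in> carrier (Deg L 1)) \<and>
      lift 1 ((Bracket (formal L) 0 1 x ^^ j) f) = (conv (lbr 0 1) (lift 0 x) ^^ j) (lift 1 f)"
  proof (induction j)
    case (Suc j)
    then show ?case
      using emb_formal_bracket[OF assms(1), of "(Bracket (formal L) 0 1 x ^^ j) f" 1 1]
        formal_bracket_closed[OF assms(1), of "(Bracket (formal L) 0 1 x ^^ j) f" 1 1]
      by (auto simp: fun_eq_iff)
  qed (simp add: assms)
  show "(Bracket (formal L) 0 1 x ^^ j) f n \<in> carrier (Deg L 1)"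
    using * by blast
  show "E 1 ((Bracket (formal L) 0 1 x ^^ j) f n) = (conv (lbr 0 1) (lift 0 x) ^^ j) (lift 1 f) n"
    using * by (auto dest: fun_cong[of _ _ n])
qed

lemma diff_coeff_closed: "(\<And>n. x n \<in> carrier (Deg L 0)) \<Longrightarrow> Diff (formal L) 0 x n \<in> carrier (Deg L 1)"
  using diff_closed[of "x n" 0] by (simp add: formal_def)

lemma gauge_act_coeff_closed:
  assumes "\<And>n. x n \<in> carrier (Deg L 0)" "\<And>n. \<xi> n \<in> carrier (Deg L 1)"
  shows "gauge_act R L x \<xi> m \<in> carrier (Deg L 1)"
  unfolding gauge_act_def
  by (intro Deg.M.minus_closed Deg.M.finsum_closed) (auto intro!: formal_ad assms diff_coeff_closed)

text \<open>The explicit series \<open>gauge_act\<close> is identified, by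
  \<open>T.gauge_eq\<close>, with the exponential acting on \<delta> + \<xi>.\<close>

lemma emb_gauge_act:
  assumes x: "x \<in> carrier (Deg (formal L) 0)" and \<xi>: "\<xi> \<in> carrier (Deg (formal L) 1)"
  shows "E 1 (gauge_act R L x \<xi> m) = T.gauge (lift 0 x) (lift 1 \<xi>) m"
proof -
  have cl: "x n \<in> carrier (Deg L 0)" "\<xi> n \<in> carrier (Deg L 1)" "lift 0 x 0 = 0" for n
    using x \<xi> by (auto simp: formal_carrier)
  have dx: "lift 1 (Diff (formal L) 0 x) = (\<lambda>n. ldiff 0 (lift 0 x n))"
    using ldiff_emb[OF cl(1)] by (simp add: formal_def fun_eq_iff)
  have "E 1 (gauge_act R L x \<xi> m) =
      (\<Sum>j\<le>m. (1 / fact j) *\<^sub>Q E 1 ((Bracket (formal L) 0 1 x ^^ j) \<xi> m))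
      - (\<Sum>j\<le>m. (1 / fact (1 + j)) *\<^sub>Q E 1 ((Bracket (formal L) 0 1 x ^^ j) (Diff (formal L) 0 x) m))"
    using formal_ad(1)[of x \<xi>] formal_ad(1)[of x "Diff (formal L) 0 x"] cl diff_coeff_closed
    by (simp add: gauge_act_def Deg.emb_minus Deg.emb_finsum Deg.emb_qsmult Deg.M.finsum_closed Pi_iff
        del: fact_Suc)
  also have "\<dots> = T.gauge (lift 0 x) (lift 1 \<xi>) m"
    using formal_ad(2)[of x \<xi>] formal_ad(2)[of x "Diff (formal L) 0 x"] cl diff_coeff_closed
    by (simp add: T.gauge_eq dx del: fact_Suc)
  finally show ?thesis .
qed

lemma gauge_act_closed:
  assumes x: "x \<in> carrier (Deg (formal L) 0)" and \<xi>: "\<xi> \<in> carrier (Deg (formal L) 1)"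
  shows "gauge_act R L x \<xi> \<in> carrier (Deg (formal L) 1)"
proof -
  have cl: "gauge_act R L x \<xi> n \<in> carrier (Deg L 1)" for n
    using x \<xi> by (intro gauge_act_coeff_closed) (auto simp: formal_carrier)
  have "E 1 (gauge_act R L x \<xi> 0) = E 1 \<zero>\<^bsub>Deg L 1\<^esub>"
    using x \<xi> unfolding emb_gauge_act[OF x \<xi>]
    by (subst T.gauge_eq) (auto simp: formal_carrier T.d0.zero)
  then have "gauge_act R L x \<xi> 0 = \<zero>\<^bsub>Deg L 1\<^esub>"
    using cl by (simp add: Deg.emb_inject del: Deg.emb_zero)
  with cl show ?thesis by (simp add: formal_carrier)
qed

lemma lift_inject:
  "\<xi> \<in> carrier (Deg (formal L) i) \<Longrightarrow> \<eta> \<in> carrier (Deg (formal L) i) \<Longrightarrow> lift i \<xi> = lift i \<eta> \<Longrightarrow> \<xi> = \<eta>"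
  by (auto simp: formal_carrier fun_eq_iff Deg.emb_inject)

lemma lift_0_0: "x \<in> carrier (Deg (formal L) 0) \<Longrightarrow> lift 0 x 0 = 0"
  by (simp add: formal_carrier)

lemma lift_gauge_act:
  "x \<in> carrier (Deg (formal L) 0) \<Longrightarrow> \<xi> \<in> carrier (Deg (formal L) 1) \<Longrightarrow>
    lift 1 (gauge_act R L x \<xi>) = T.gauge (lift 0 x) (lift 1 \<xi>)"
  by (simp add: fun_eq_iff emb_gauge_act)

lemma zero_formal: "(\<lambda>n. \<zero>\<^bsub>Deg L i\<^esub>) \<in> carrier (Deg (formal L) i)"
  by (simp add: formal_carrier)

lemma gauge_act_zero:
  assumes "\<xi> \<in> carrier (Deg (formal L) 1)"
  shows "gauge_act R L (\<lambda>n. \<zero>\<^bsub>Deg L 0\<^esub>) \<xi> = \<xi>"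
proof (rule lift_inject[OF gauge_act_closed])
  have "lift 0 (\<lambda>n. \<zero>\<^bsub>Deg L 0\<^esub>) = 0" by (simp add: fun_eq_iff)
  then show "lift 1 (gauge_act R L (\<lambda>n. \<zero>\<^bsub>Deg L 0\<^esub>) \<xi>) = lift 1 \<xi>"
    by (simp only: lift_gauge_act zero_formal assms T.gauge_zero)
qed (simp_all add: zero_formal assms)

text \<open>The lifted operations only see the image of \<open>V\<close>, so gauge parameters can be pulled back.\<close>

lemma ex_lift_gauge:
  assumes "z 0 = 0"
  shows "\<exists>z'\<in>carrier (Deg (formal L) 0). T.gauge (lift 0 z') = T.gauge z"
proof
  let ?z = "\<lambda>n. V 0 (z n)"
  show z: "?z \<in> carrier (Deg (formal L) 0)"
    using assms by (simp add: formal_carrier)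
  have "conv (lbr 0 1) (lift 0 ?z) = conv (lbr 0 1) z" "ldiff 0 (lift 0 ?z n) = ldiff 0 (z n)" for n
    by (simp_all add: conv_def lbr_def ldiff_def fun_eq_iff)
  then have "T.gauge (lift 0 ?z) \<xi> m = T.gauge z \<xi> m" for \<xi> m
    by (simp only: T.gauge_eq[where x = z, OF assms] T.gauge_eq[where x = "lift 0 ?z", OF lift_0_0[OF z]])
  then show "T.gauge (lift 0 ?z) = T.gauge z"
    by (simp add: fun_eq_iff)
qed

lemma ex_gauge_act_mult:
  assumes x: "x \<in> carrier (Deg (formal L) 0)" and y: "y \<in> carrier (Deg (formal L) 0)"
  shows "\<exists>z\<in>carrier (Deg (formal L) 0). \<forall>\<xi>\<in>carrier (Deg (formal L) 1).
    gauge_act R L x (gauge_act R L y \<xi>) = gauge_act R L z \<xi>"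
proof -
  obtain z0 where "z0 0 = 0" and z0: "\<And>\<xi>. T.gauge (lift 0 x) (T.gauge (lift 0 y) \<xi>) = T.gauge z0 \<xi>"
    using T.ex_gauge_mult[where x = "lift 0 x" and y = "lift 0 y"] lift_0_0[OF x] lift_0_0[OF y] by metis
  then obtain z where z: "z \<in> carrier (Deg (formal L) 0)" "T.gauge (lift 0 z) = T.gauge z0"
    using ex_lift_gauge by metis
  have "gauge_act R L x (gauge_act R L y \<xi>) = gauge_act R L z \<xi>"
    if \<xi>: "\<xi> \<in> carrier (Deg (formal L) 1)" for \<xi>
    by (rule lift_inject[where i = 1]) (simp_all only: gauge_act_closed lift_gauge_act x y z \<xi> z0)
  with z show ?thesis by blast
qed

lemma ex_gauge_act_inverse:
  assumes x: "x \<in> carrier (Deg (formal L) 0)"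
  shows "\<exists>y\<in>carrier (Deg (formal L) 0). \<forall>\<xi>\<in>carrier (Deg (formal L) 1).
    gauge_act R L y (gauge_act R L x \<xi>) = \<xi>"
proof -
  obtain y0 where "y0 0 = 0" and y0: "\<And>\<xi>. T.gauge y0 (T.gauge (lift 0 x) \<xi>) = \<xi>"
    using T.ex_gauge_inverse[where x = "lift 0 x"] lift_0_0[OF x] by metis
  then obtain y where y: "y \<in> carrier (Deg (formal L) 0)" "T.gauge (lift 0 y) = T.gauge y0"
    using ex_lift_gauge by metis
  have "gauge_act R L y (gauge_act R L x \<xi>) = \<xi>" if \<xi>: "\<xi> \<in> carrier (Deg (formal L) 1)" for \<xi>
    by (rule lift_inject[where i = 1]) (simp_all only: gauge_act_closed lift_gauge_act x y \<xi> y0)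
  with y show ?thesis by blast
qed

lemma MC_iff:
  "\<xi> \<in> MC R (formal L) \<longleftrightarrow> \<xi> \<in> carrier (Deg (formal L) 1) \<and>
    (\<forall>n. 2 *\<^sub>Q ldiff 1 (lift 1 \<xi> n) + conv (lbr 1 1) (lift 1 \<xi>) (lift 1 \<xi>) n = 0)"
proof (cases "\<xi> \<in> carrier (Deg (formal L) 1)")
  case True
  then have cl: "\<xi> n \<in> carrier (Deg L 1)" for n
    by (simp add: formal_carrier)
  let ?B = "Bracket (formal L) 1 1 \<xi> \<xi>"
  have B: "?B n \<in> carrier (Deg L 2)" "E 2 (?B n) = conv (lbr 1 1) (lift 1 \<xi>) (lift 1 \<xi>) n" for n
    using formal_bracket_closed[of \<xi> 1 \<xi> 1 2 n] emb_formal_bracket[of \<xi> 1 \<xi> 1 2 n] cl by auto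
  have D: "Diff L 1 (\<xi> n) \<in> carrier (Deg L 2)" "E 2 (Diff L 1 (\<xi> n)) = ldiff 1 (lift 1 \<xi> n)" for n
    using diff_closed[OF cl[of n]] ldiff_emb[OF cl[of n]] by simp_all
  have "\<xi> \<in> MC R (formal L) \<longleftrightarrow>
      (\<forall>n. Diff L 1 (\<xi> n) \<oplus>\<^bsub>Deg L 2\<^esub> rat_embed R (1 / 2) \<odot>\<^bsub>Deg L 2\<^esub> ?B n = \<zero>\<^bsub>Deg L 2\<^esub>)"
    using True by (simp add: MC_def fun_eq_iff) (simp add: formal_def formal_module_def)
  also have "\<dots> \<longleftrightarrow> (\<forall>n. E 2 (Diff L 1 (\<xi> n) \<oplus>\<^bsub>Deg L 2\<^esub> rat_embed R (1 / 2) \<odot>\<^bsub>Deg L 2\<^esub> ?B n)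
      = E 2 \<zero>\<^bsub>Deg L 2\<^esub>)"
    using B D by (subst Deg.emb_inject) auto
  \<comment> \<open>Doubling is injective over the rationals and brings the equation into the form
    of \<open>curvature_shift\<close>.\<close>
  also have "\<dots> \<longleftrightarrow> (\<forall>n. 2 *\<^sub>Q (ldiff 1 (lift 1 \<xi> n)
      + (1 / 2) *\<^sub>Q conv (lbr 1 1) (lift 1 \<xi>) (lift 1 \<xi>) n) = 0)"
    using B D by (simp add: Deg.emb_add Deg.emb_qsmult)
  finally show ?thesis
    using True by (simp add: scaleQ_add_right)
qed (simp add: MC_def)

lemma gauge_act_MC:
  assumes x: "x \<in> carrier (Deg (formal L) 0)" and \<xi>: "\<xi> \<in> MC R (formal L)"
  shows "gauge_act R L x \<xi> \<in> MC R (formal L)"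
proof -
  have \<xi>1: "\<xi> \<in> carrier (Deg (formal L) 1)"
    and curv: "2 *\<^sub>Q ldiff 1 (lift 1 \<xi> n) + conv (lbr 1 1) (lift 1 \<xi>) (lift 1 \<xi>) n = 0" for n
    using \<xi> by (simp_all add: MC_iff)
  show ?thesis
    unfolding MC_iff lift_gauge_act[OF x \<xi>1] emb_gauge_act[OF x \<xi>1]
    using T.gauge_curvature[where x = "lift 0 x", OF lift_0_0[OF x] curv] gauge_act_closed[OF x \<xi>1] by blast
qed

end

section \<open>Gauge classes partition the Maurer-Cartan elements\<close>

context rat_dgla
begin

lemma gauge_class_eq:
  "gauge_class R L \<xi> = {gauge_act R L x \<xi> | x. x \<in> carrier (Deg (formal L) 0)}"
  by (simp add: gauge_class_def orbit_def gauge_group_def)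

lemma gauge_quotient_eq: "gauge_quotient R L = gauge_class R L ` MC R (formal L)"
  by (auto simp: gauge_quotient_def orbits_def gauge_class_def)

lemma MC_carrier: "\<xi> \<in> MC R (formal L) \<Longrightarrow> \<xi> \<in> carrier (Deg (formal L) 1)"
  by (simp add: MC_def)

lemma gauge_class_refl: "\<xi> \<in> MC R (formal L) \<Longrightarrow> \<xi> \<in> gauge_class R L \<xi>"
  unfolding gauge_class_eq using gauge_act_zero[OF MC_carrier, symmetric] zero_formal[of 0] by blast

lemma gauge_class_subset: "\<xi> \<in> MC R (formal L) \<Longrightarrow> gauge_class R L \<xi> \<subseteq> MC R (formal L)"
  unfolding gauge_class_eq using gauge_act_MC by blast

lemma gauge_class_trans:
  assumes \<xi>: "\<xi> \<in> MC R (formal L)" and "\<eta> \<in> gauge_class R L \<xi>"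
  shows "gauge_class R L \<eta> \<subseteq> gauge_class R L \<xi>"
proof
  fix \<zeta> assume "\<zeta> \<in> gauge_class R L \<eta>"
  then obtain x y where x: "x \<in> carrier (Deg (formal L) 0)" and y: "y \<in> carrier (Deg (formal L) 0)"
    and \<zeta>: "\<zeta> = gauge_act R L y (gauge_act R L x \<xi>)"
    using assms unfolding gauge_class_eq by blast
  obtain z where "z \<in> carrier (Deg (formal L) 0)" "\<zeta> = gauge_act R L z \<xi>"
    using ex_gauge_act_mult[OF y x] MC_carrier[OF \<xi>] \<zeta> by auto
  then show "\<zeta> \<in> gauge_class R L \<xi>"
    unfolding gauge_class_eq by blast
qed

lemma gauge_class_sym:
  assumes \<xi>: "\<xi> \<in> MC R (formal L)" and "\<eta> \<in> gauge_class R L \<xi>"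
  shows "\<xi> \<in> gauge_class R L \<eta>"
proof -
  obtain x where x: "x \<in> carrier (Deg (formal L) 0)" "\<eta> = gauge_act R L x \<xi>"
    using assms unfolding gauge_class_eq by blast
  then obtain y where "y \<in> carrier (Deg (formal L) 0)" "\<xi> = gauge_act R L y \<eta>"
    using ex_gauge_act_inverse[OF x(1)] MC_carrier[OF \<xi>] by fastforce
  then show ?thesis
    unfolding gauge_class_eq by blast
qed

lemma gauge_class_cong:
  assumes \<xi>: "\<xi> \<in> MC R (formal L)" and \<eta>: "\<eta> \<in> gauge_class R L \<xi>"
  shows "gauge_class R L \<eta> = gauge_class R L \<xi>"
  using gauge_class_trans[OF \<xi> \<eta>] gauge_class_trans[OF _ gauge_class_sym[OF \<xi> \<eta>]]
    gauge_class_subset[OF \<xi>] \<eta> by blast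

lemma partition_gauge_quotient: "partition_on (MC R (formal L)) (gauge_quotient R L)"
proof (rule partition_onI)
  show "\<Union> (gauge_quotient R L) = MC R (formal L)"
    unfolding gauge_quotient_eq using gauge_class_refl gauge_class_subset by blast
  show "{} \<notin> gauge_quotient R L"
    using gauge_class_refl unfolding gauge_quotient_eq by blast
  show "disjnt p q" if "p \<in> gauge_quotient R L" "q \<in> gauge_quotient R L" "p \<noteq> q" for p q
    using that gauge_class_cong unfolding gauge_quotient_eq disjnt_def by blast
qed

lemma gauge_quotientE:
  assumes "C \<in> gauge_quotient R L" "\<xi> \<in> C"
  shows "\<xi> \<in> MC R (formal L)" "C = gauge_class R L \<xi>"
  using assms gauge_class_subset gauge_class_cong unfolding gauge_quotient_eq by blast+

end

section \<open>Functoriality\<close>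

lemma linear_mapsD:
  assumes "f \<in> linear_maps R M N"
  shows "x \<in> carrier M \<Longrightarrow> f x \<in> carrier N"
    and "x \<in> carrier M \<Longrightarrow> y \<in> carrier M \<Longrightarrow> f (x \<oplus>\<^bsub>M\<^esub> y) = f x \<oplus>\<^bsub>N\<^esub> f y"
    and "a \<in> carrier R \<Longrightarrow> x \<in> carrier M \<Longrightarrow> f (a \<odot>\<^bsub>M\<^esub> x) = a \<odot>\<^bsub>N\<^esub> f x"
  using assms by (auto simp: linear_maps_def)

locale linear_map = M: module R M + N: module R N
  for R :: "('r, 'm) ring_scheme" and M :: "('r, 'a) module" and N :: "('r, 'b) module" +
  fixes f assumes linear: "f \<in> linear_maps R M N"
begin

lemma closed [simp]: "x \<in> carrier M \<Longrightarrow> f x \<in> carrier N"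
  and add: "x \<in> carrier M \<Longrightarrow> y \<in> carrier M \<Longrightarrow> f (x \<oplus>\<^bsub>M\<^esub> y) = f x \<oplus>\<^bsub>N\<^esub> f y"
  and smult: "a \<in> carrier R \<Longrightarrow> x \<in> carrier M \<Longrightarrow> f (a \<odot>\<^bsub>M\<^esub> x) = a \<odot>\<^bsub>N\<^esub> f x"
  using linear_mapsD[OF linear] by auto

lemma zero [simp]: "f \<zero>\<^bsub>M\<^esub> = \<zero>\<^bsub>N\<^esub>"
  using add[of "\<zero>\<^bsub>M\<^esub>" "\<zero>\<^bsub>M\<^esub>"] by (simp add: N.add.l_cancel_one')

lemma minus: "x \<in> carrier M \<Longrightarrow> y \<in> carrier M \<Longrightarrow> f (x \<ominus>\<^bsub>M\<^esub> y) = f x \<ominus>\<^bsub>N\<^esub> f y"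
proof -
  assume xy: "x \<in> carrier M" "y \<in> carrier M"
  then have "f (x \<ominus>\<^bsub>M\<^esub> y) \<oplus>\<^bsub>N\<^esub> f y = f x"
    by (simp add: M.M.minus_eq M.M.a_assoc M.M.l_neg flip: add)
  with xy show ?thesis
    by (metis M.M.minus_closed N.M.minus_eq N.add.inv_solve_right' closed)
qed

lemma finsum: "g \<in> A \<rightarrow> carrier M \<Longrightarrow> f (finsum M g A) = (\<Oplus>\<^bsub>N\<^esub>a\<in>A. f (g a))"
  by (induction A rule: infinite_finite_induct) (auto simp: add Pi_iff)

end

locale rat_dgla_map = L: rat_dgla R L + K: rat_dgla R K
  for R :: "('r, 'm) ring_scheme" and L :: "('r, 'a) dgla" and K :: "('r, 'b) dgla" +
  fixes \<phi> :: "int \<Rightarrow> 'a \<Rightarrow> 'b"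
  assumes map: "\<phi> \<in> dgla_maps R L K"
begin

sublocale linear_map R "Deg L i" "Deg K i" "\<phi> i" for i
  using map by (simp add: linear_map_def linear_map_axioms_def L.module_Deg K.module_Deg dgla_maps_def)

lemma map_bracket:
  "x \<in> carrier (Deg L i) \<Longrightarrow> y \<in> carrier (Deg L j) \<Longrightarrow> i + j = k \<Longrightarrow>
    \<phi> k (Bracket L i j x y) = Bracket K i j (\<phi> i x) (\<phi> j y)"
  using map by (auto simp: dgla_maps_def)

lemma map_diff: "x \<in> carrier (Deg L i) \<Longrightarrow> i + 1 = k \<Longrightarrow> \<phi> k (Diff L i x) = Diff K i (\<phi> i x)"
  using map by (auto simp: dgla_maps_def)

lemma formal_map_closed:
  "x \<in> carrier (Deg (formal L) i) \<Longrightarrow> formal_map (\<phi> i) x \<in> carrier (Deg (formal K) i)"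
  by (simp add: L.formal_carrier K.formal_carrier formal_map_def)

lemma map_formal_bracket:
  assumes "\<And>n. x n \<in> carrier (Deg L i)" "\<And>n. y n \<in> carrier (Deg L j)" "i + j = k"
  shows "\<phi> k (Bracket (formal L) i j x y n) =
    Bracket (formal K) i j (formal_map (\<phi> i) x) (formal_map (\<phi> j) y) n"
  using assms by (auto simp: formal_def formal_map_def finsum map_bracket Pi_iff
      intro!: K.Deg.M.finsum_cong')

lemma map_formal_ad:
  assumes x: "\<And>n. x n \<in> carrier (Deg L 0)" and y: "\<And>n. y n \<in> carrier (Deg L 1)"
  shows "formal_map (\<phi> 1) ((Bracket (formal L) 0 1 x ^^ j) y) =
    (Bracket (formal K) 0 1 (formal_map (\<phi> 0) x) ^^ j) (formal_map (\<phi> 1) y)"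
proof (induction j)
  case (Suc j)
  let ?w = "(Bracket (formal L) 0 1 x ^^ j) y"
  have "formal_map (\<phi> 1) (Bracket (formal L) 0 1 x ?w) n =
      Bracket (formal K) 0 1 (formal_map (\<phi> 0) x) (formal_map (\<phi> 1) ?w) n" for n
    using map_formal_bracket[where x = x and y = ?w and i = 0 and j = 1 and k = 1, OF x
        L.formal_ad(1)[where x = x and f = y, OF x y]]
    by (simp add: formal_map_def[of _ "Bracket _ _ _ _ _"])
  then have "formal_map (\<phi> 1) (Bracket (formal L) 0 1 x ?w) =
      Bracket (formal K) 0 1 (formal_map (\<phi> 0) x) (formal_map (\<phi> 1) ?w)" ..
  then show ?case by (simp only: funpow.simps comp_def Suc)
qed simp

text \<open>Each coefficient is a finite combination of iterated brackets and differentials, all of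
  which a DGLA morphism respects.\<close>

lemma formal_map_gauge_act:
  assumes "x \<in> carrier (Deg (formal L) 0)" "\<xi> \<in> carrier (Deg (formal L) 1)"
  shows "formal_map (\<phi> 1) (gauge_act R L x \<xi>) =
    gauge_act R K (formal_map (\<phi> 0) x) (formal_map (\<phi> 1) \<xi>)"
proof
  fix m
  have x: "x n \<in> carrier (Deg L 0)" and \<xi>: "\<xi> n \<in> carrier (Deg L 1)" for n
    using assms by (auto simp: L.formal_carrier)
  have dx: "Diff (formal L) 0 x n \<in> carrier (Deg L 1)" for n
    by (rule L.diff_coeff_closed) (rule x)
  have d: "formal_map (\<phi> 1) (Diff (formal L) 0 x) = Diff (formal K) 0 (formal_map (\<phi> 0) x)"
    using x by (simp add: formal_def formal_map_def map_diff)
  have ad: "\<phi> 1 ((Bracket (formal L) 0 1 x ^^ j) y m) =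
      (Bracket (formal K) 0 1 (formal_map (\<phi> 0) x) ^^ j) (formal_map (\<phi> 1) y) m"
    if "\<And>n. y n \<in> carrier (Deg L 1)" for j y
    using fun_cong[OF map_formal_ad[where x = x and y = y and j = j, OF x that], of m] by (simp add: formal_map_def)
  show "formal_map (\<phi> 1) (gauge_act R L x \<xi>) m =
      gauge_act R K (formal_map (\<phi> 0) x) (formal_map (\<phi> 1) \<xi>) m"
    unfolding formal_map_def[of _ "gauge_act R L x \<xi>"]
    unfolding gauge_act_def d[symmetric]
      ad[OF \<xi>, symmetric] ad[OF dx, symmetric]
    using L.formal_ad(1)[where x = x and f = \<xi>, OF x \<xi>]
      L.formal_ad(1)[where x = x and f = "Diff (formal L) 0 x", OF x dx]
    by (subst minus) (auto simp: finsum smult intro!: L.Deg.M.finsum_closed)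
qed

lemma formal_map_MC:
  assumes "\<xi> \<in> MC R (formal L)"
  shows "formal_map (\<phi> 1) \<xi> \<in> MC R (formal K)"
proof -
  have \<xi>: "\<xi> n \<in> carrier (Deg L 1)" for n
    using L.MC_carrier[OF assms] by (auto simp: L.formal_carrier)
  have B: "Bracket (formal L) 1 1 \<xi> \<xi> n \<in> carrier (Deg L 2)" for n
    by (rule L.formal_bracket_closed) (auto simp: \<xi>)
  have D: "Diff L 1 (\<xi> n) \<in> carrier (Deg L 2)" for n
    using L.diff_closed[OF \<xi>[of n]] by simp
  have eq: "Diff L 1 (\<xi> n) \<oplus>\<^bsub>Deg L 2\<^esub> rat_embed R (1 / 2) \<odot>\<^bsub>Deg L 2\<^esub> Bracket (formal L) 1 1 \<xi> \<xi> n
      = \<zero>\<^bsub>Deg L 2\<^esub>" for n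
    using assms by (simp add: MC_def fun_eq_iff) (simp add: formal_def formal_module_def)
  have "Diff K 1 (formal_map (\<phi> 1) \<xi> n) \<oplus>\<^bsub>Deg K 2\<^esub> rat_embed R (1 / 2) \<odot>\<^bsub>Deg K 2\<^esub>
      Bracket (formal K) 1 1 (formal_map (\<phi> 1) \<xi>) (formal_map (\<phi> 1) \<xi>) n = \<zero>\<^bsub>Deg K 2\<^esub>" for n
  proof -
    have "Diff K 1 (formal_map (\<phi> 1) \<xi> n) = \<phi> 2 (Diff L 1 (\<xi> n))"
      using map_diff[OF \<xi>[of n], of 2] by (simp add: formal_map_def)
    moreover have "Bracket (formal K) 1 1 (formal_map (\<phi> 1) \<xi>) (formal_map (\<phi> 1) \<xi>) n =
        \<phi> 2 (Bracket (formal L) 1 1 \<xi> \<xi> n)"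
      using map_formal_bracket[where x = \<xi> and y = \<xi> and k = 2, OF \<xi> \<xi>] by simp
    ultimately show ?thesis
      using eq[of n] by (simp add: B D flip: smult add)
  qed
  then show ?thesis
    using formal_map_closed[OF L.MC_carrier[OF assms]]
    by (simp add: MC_def fun_eq_iff) (simp add: formal_def formal_module_def)
qed

lemma induced_map_class:
  assumes \<xi>: "\<xi> \<in> MC R (formal L)"
  shows "induced_map R L K (\<phi> 1) (gauge_class R L \<xi>) = gauge_class R K (formal_map (\<phi> 1) \<xi>)"
proof -
  \<comment> \<open>\<open>induced_map\<close> takes a union over representatives; by naturality of
    the action all members of that union coincide.\<close>
  have const: "gauge_class R K (formal_map (\<phi> 1) \<eta>) = gauge_class R K (formal_map (\<phi> 1) \<xi>)"
    if "\<eta> \<in> gauge_class R L \<xi>" for \<eta>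
  proof (rule K.gauge_class_cong[OF formal_map_MC[OF \<xi>]])
    show "formal_map (\<phi> 1) \<eta> \<in> gauge_class R K (formal_map (\<phi> 1) \<xi>)"
      using that formal_map_gauge_act[OF _ L.MC_carrier[OF \<xi>]] formal_map_closed
      unfolding L.gauge_class_eq K.gauge_class_eq by blast
  qed
  have "(\<Union>\<eta>\<in>gauge_class R L \<xi>. gauge_class R K (formal_map (\<phi> 1) \<eta>)) =
      gauge_class R K (formal_map (\<phi> 1) \<xi>)"
    by (rule SUP_eq_const) (use L.gauge_class_refl[OF \<xi>] in blast, rule const)
  then show ?thesis
    using \<xi> by (simp add: induced_map_def L.gauge_quotient_eq)
qed

lemma induced_map_funcset: "induced_map R L K (\<phi> 1) \<in> gauge_quotient R L \<rightarrow>\<^sub>E gauge_quotient R K"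
proof
  fix C assume "C \<in> gauge_quotient R L"
  then show "induced_map R L K (\<phi> 1) C \<in> gauge_quotient R K"
    using induced_map_class formal_map_MC by (auto simp: L.gauge_quotient_eq K.gauge_quotient_eq)
qed (simp add: induced_map_def)

end

section \<open>Congruence modulo the ideal and its invariance under gauge transformations\<close>

context rat_dgla
begin

text \<open>The additive inverse is a definite description, so the coefficientwise negative is shown
  to be the unique solution of its defining equations.\<close>

lemma formal_minus:
  assumes f: "f \<in> carrier (Deg (formal L) i)" and g: "g \<in> carrier (Deg (formal L) i)"
  shows "(f \<ominus>\<^bsub>Deg (formal L) i\<^esub> g) n = f n \<ominus>\<^bsub>Deg L i\<^esub> g n"
proof -
  have cl: "g n \<in> carrier (Deg L i)" "g 0 = \<zero>\<^bsub>Deg L i\<^esub>" for n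
    using g by (auto simp: formal_carrier)
  have "\<ominus>\<^bsub>Deg (formal L) i\<^esub> g = (\<lambda>n. \<ominus>\<^bsub>Deg L i\<^esub> g n)"
    unfolding a_inv_def m_inv_def[of "add_monoid (Deg (formal L) i)"]
  proof (rule the_equality, goal_cases)
    case 1
    show ?case
      using cl by (simp add: formal_def formal_module_def fun_eq_iff Deg.M.r_neg Deg.M.l_neg
          flip: a_inv_def)
  next
    case (2 h)
    then have "h n \<in> carrier (Deg L i)" "h n \<oplus>\<^bsub>Deg L i\<^esub> g n = \<zero>\<^bsub>Deg L i\<^esub>" for n
      by (auto simp: formal_def formal_module_def fun_eq_iff)
    then have "h n = \<ominus>\<^bsub>Deg L i\<^esub> g n" for n
      using cl by (metis Deg.M.minus_equality)
    then show ?case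
      by (simp add: fun_eq_iff flip: a_inv_def)
  qed
  then show ?thesis
    by (simp add: a_minus_def) (simp add: formal_def formal_module_def)
qed

end

locale rat_dgla_ideal = rat_dgla R L
  for R :: "('r, 'm) ring_scheme" and L :: "('r, 'a) dgla" +
  fixes I :: "'a set"
  assumes submodule: "submodule I R (Deg L 1)"
    and bracket_ideal: "x \<in> carrier (Deg L 0) \<Longrightarrow> y \<in> I \<Longrightarrow> Bracket L 0 1 x y \<in> I"
begin

lemma ideal_zero: "\<zero>\<^bsub>Deg L 1\<^esub> \<in> I"
  and ideal_add: "x \<in> I \<Longrightarrow> y \<in> I \<Longrightarrow> x \<oplus>\<^bsub>Deg L 1\<^esub> y \<in> I"
  and ideal_uminus: "x \<in> I \<Longrightarrow> \<ominus>\<^bsub>Deg L 1\<^esub> x \<in> I"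
  and ideal_smult: "a \<in> carrier R \<Longrightarrow> x \<in> I \<Longrightarrow> a \<odot>\<^bsub>Deg L 1\<^esub> x \<in> I"
proof -
  interpret I: submodule I R "Deg L 1" by (rule submodule)
  show "\<zero>\<^bsub>Deg L 1\<^esub> \<in> I"
    "x \<in> I \<Longrightarrow> y \<in> I \<Longrightarrow> x \<oplus>\<^bsub>Deg L 1\<^esub> y \<in> I"
    "a \<in> carrier R \<Longrightarrow> x \<in> I \<Longrightarrow> a \<odot>\<^bsub>Deg L 1\<^esub> x \<in> I"
    using I.one_closed I.m_closed I.smult_closed by simp_all
  show "x \<in> I \<Longrightarrow> \<ominus>\<^bsub>Deg L 1\<^esub> x \<in> I"
    using I.m_inv_closed by (simp add: a_inv_def)
qed

definition cong :: "'a \<Rightarrow> 'a \<Rightarrow> bool" where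
  "cong x y \<longleftrightarrow> x \<in> carrier (Deg L 1) \<and> y \<in> carrier (Deg L 1) \<and> x \<ominus>\<^bsub>Deg L 1\<^esub> y \<in> I"

lemma cong_refl: "x \<in> carrier (Deg L 1) \<Longrightarrow> cong x x"
  by (simp add: cong_def Deg.M.minus_eq Deg.M.r_neg ideal_zero)

lemma cong_sym:
  assumes "cong x y" shows "cong y x"
proof -
  have "y \<ominus>\<^bsub>Deg L 1\<^esub> x = \<ominus>\<^bsub>Deg L 1\<^esub> (x \<ominus>\<^bsub>Deg L 1\<^esub> y)"
    using assms by (simp add: cong_def Deg.M.minus_eq Deg.M.minus_add Deg.M.a_comm)
  then show ?thesis
    using assms ideal_uminus by (simp add: cong_def)
qed

lemma cong_add:
  assumes "cong x y" "cong u v" shows "cong (x \<oplus>\<^bsub>Deg L 1\<^esub> u) (y \<oplus>\<^bsub>Deg L 1\<^esub> v)"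
proof -
  have "(x \<oplus>\<^bsub>Deg L 1\<^esub> u) \<ominus>\<^bsub>Deg L 1\<^esub> (y \<oplus>\<^bsub>Deg L 1\<^esub> v) = (x \<ominus>\<^bsub>Deg L 1\<^esub> y) \<oplus>\<^bsub>Deg L 1\<^esub> (u \<ominus>\<^bsub>Deg L 1\<^esub> v)"
    using assms by (simp add: cong_def Deg.M.minus_eq Deg.M.minus_add Deg.M.a_ac)
  then show ?thesis
    using assms ideal_add by (simp add: cong_def)
qed

lemma cong_trans:
  assumes "cong x y" "cong y z" shows "cong x z"
proof -
  have "x \<ominus>\<^bsub>Deg L 1\<^esub> z = (x \<ominus>\<^bsub>Deg L 1\<^esub> y) \<oplus>\<^bsub>Deg L 1\<^esub> (y \<ominus>\<^bsub>Deg L 1\<^esub> z)"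
    using assms by (simp add: cong_def Deg.M.minus_eq Deg.M.a_assoc Deg.M.r_neg1)
  then show ?thesis
    using assms ideal_add by (simp add: cong_def)
qed

lemma cong_uminus:
  assumes "cong x y" shows "cong (\<ominus>\<^bsub>Deg L 1\<^esub> x) (\<ominus>\<^bsub>Deg L 1\<^esub> y)"
proof -
  have "(\<ominus>\<^bsub>Deg L 1\<^esub> x) \<ominus>\<^bsub>Deg L 1\<^esub> (\<ominus>\<^bsub>Deg L 1\<^esub> y) = y \<ominus>\<^bsub>Deg L 1\<^esub> x"
    using assms by (simp add: cong_def Deg.M.minus_eq Deg.M.a_comm)
  then show ?thesis
    using cong_sym[OF assms] assms by (simp add: cong_def)
qed

lemma cong_linear:
  assumes f: "f \<in> linear_maps R (Deg L 1) (Deg L 1)" and I: "\<And>x. x \<in> I \<Longrightarrow> f x \<in> I" and "cong x y"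
  shows "cong (f x) (f y)"
proof -
  interpret linear_map R "Deg L 1" "Deg L 1" f
    by (simp add: linear_map_def linear_map_axioms_def module_Deg f)
  show ?thesis
    using assms(3) I[of "x \<ominus>\<^bsub>Deg L 1\<^esub> y"] by (simp add: cong_def minus)
qed

lemma cong_smult:
  assumes a: "a \<in> carrier R" and cong: "cong x y"
  shows "cong (a \<odot>\<^bsub>Deg L 1\<^esub> x) (a \<odot>\<^bsub>Deg L 1\<^esub> y)"
proof (rule cong_linear[OF _ ideal_smult[OF a] cong])
  have "a \<odot>\<^bsub>Deg L 1\<^esub> (b \<odot>\<^bsub>Deg L 1\<^esub> z) = b \<odot>\<^bsub>Deg L 1\<^esub> (a \<odot>\<^bsub>Deg L 1\<^esub> z)"
    if "b \<in> carrier R" "z \<in> carrier (Deg L 1)" for b z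
    using that a by (metis Deg.smult_assoc1 Deg.R.m_comm)
  then show "(\<odot>\<^bsub>Deg L 1\<^esub>) a \<in> linear_maps R (Deg L 1) (Deg L 1)"
    using a by (simp add: linear_maps_def Deg.smult_r_distr)
qed

lemma cong_bracket:
  assumes x: "x \<in> carrier (Deg L 0)" and cong: "cong u v"
  shows "cong (Bracket L 0 1 x u) (Bracket L 0 1 x v)"
  using bracket_linear_right[OF x, of 1] by (intro cong_linear[OF _ bracket_ideal[OF x] cong]) simp

lemma cong_finsum:
  "(\<And>a. a \<in> A \<Longrightarrow> cong (f a) (g a)) \<Longrightarrow> cong (\<Oplus>\<^bsub>Deg L 1\<^esub>a\<in>A. f a) (\<Oplus>\<^bsub>Deg L 1\<^esub>a\<in>A. g a)"
proof (induction A rule: infinite_finite_induct)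
  case (insert a A)
  then have "f \<in> A \<rightarrow> carrier (Deg L 1)" "g \<in> A \<rightarrow> carrier (Deg L 1)"
    "f a \<in> carrier (Deg L 1)" "g a \<in> carrier (Deg L 1)"
    by (auto simp: cong_def)
  then show ?case
    using insert by (simp add: cong_add)
qed (simp_all add: cong_refl)

text \<open>Adjoint powers preserve congruence by the ideal property, and the series in
  \<open>d x\<close> is the same on both sides.\<close>

lemma cong_gauge_act:
  assumes x: "x \<in> carrier (Deg (formal L) 0)" and cong: "\<And>n. cong (\<xi> n) (\<eta> n)"
  shows "cong (gauge_act R L x \<xi> m) (gauge_act R L x \<eta> m)"
proof -
  have x': "x n \<in> carrier (Deg L 0)" for n
    using x by (simp add: formal_carrier)
  have ad: "cong ((Bracket (formal L) 0 1 x ^^ j) \<xi> n) ((Bracket (formal L) 0 1 x ^^ j) \<eta> n)" for j n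
  proof (induction j arbitrary: n)
    case (Suc j)
    have "Bracket (formal L) 0 1 x f n = (\<Oplus>\<^bsub>Deg L 1\<^esub> p\<in>{..n}. Bracket L 0 1 (x p) (f (n - p)))" for f
      by (simp add: formal_def)
    then show ?case
      using Suc by (simp add: cong_finsum cong_bracket x')
  qed (simp add: cong)
  have cl: "(\<Oplus>\<^bsub>Deg L 1\<^esub> j\<in>{..m}. rat_embed R (1 / fact (1 + j)) \<odot>\<^bsub>Deg L 1\<^esub>
        (Bracket (formal L) 0 1 x ^^ j) (Diff (formal L) 0 x) m) \<in> carrier (Deg L 1)"
    using formal_ad(1)[where x = x and f = "Diff (formal L) 0 x", OF x' diff_coeff_closed[OF x']]
    by (intro Deg.M.finsum_closed) auto
  show ?thesis
    unfolding gauge_act_def a_minus_def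
    by (intro cong_add cong_finsum cong_smult ad cong_uminus cong_refl cl) simp_all
qed

end

section \<open>Deformation sets of coisotropic DGLAs and the maps between them\<close>

locale rat_codgla = coisotropic_dgla R G
  for R :: "('r, 'm) ring_scheme" and G :: "('r, 'a, 'b) codgla" +
  assumes rationals: "contains_rationals R"
begin

sublocale Tot: rat_dgla R "Tot G"
  by (simp add: rat_dgla_def rat_dgla_axioms_def Tot rationals)

sublocale Nor: rat_dgla_ideal R "Nor G" "Ideal0 G 1"
  using Ideal0_bracket[of _ 0 _ 1] Ideal0_submodule
  by (auto simp: rat_dgla_ideal_def rat_dgla_ideal_axioms_def rat_dgla_def rat_dgla_axioms_def
      Nor rationals)

sublocale iota: rat_dgla_map R "Nor G" "Tot G" "iota G"
  by (simp add: rat_dgla_map_def rat_dgla_map_axioms_def Tot.rat_dgla_axioms Nor.rat_dgla_axioms iota)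

lemma MC_sim_iff:
  "(\<xi>, \<eta>) \<in> MC_sim R G \<longleftrightarrow> \<xi> \<in> MC R (formal (Nor G)) \<and> \<eta> \<in> MC R (formal (Nor G)) \<and>
    (\<forall>n. Nor.cong (\<xi> n) (\<eta> n))"
  using Nor.MC_carrier[of \<xi>] Nor.MC_carrier[of \<eta>]
  by (auto simp: MC_sim_def Nor.formal_minus Nor.cong_def) (auto simp: Nor.formal_carrier)

lemma MC_sim_gauge_act:
  assumes "(\<xi>, \<eta>) \<in> MC_sim R G" and "x \<in> carrier (Deg (formal (Nor G)) 0)"
  shows "(gauge_act R (Nor G) x \<xi>, gauge_act R (Nor G) x \<eta>) \<in> MC_sim R G"
  using assms by (simp add: MC_sim_iff Nor.gauge_act_MC Nor.cong_gauge_act)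

lemma equiv_Sim: "equiv (gauge_quotient R (Nor G)) (Sim (Def_obj R G))"
proof (rule equivI)
  let ?Q = "gauge_quotient R (Nor G)"
  have Sim: "(C, D) \<in> Sim (Def_obj R G) \<longleftrightarrow>
      C \<in> ?Q \<and> D \<in> ?Q \<and> (\<exists>\<xi>\<in>C. \<exists>\<eta>\<in>D. (\<xi>, \<eta>) \<in> MC_sim R G)" for C D
    by (simp add: Def_obj_def)
  show "Sim (Def_obj R G) \<subseteq> ?Q \<times> ?Q"
    using Sim by auto
  show "refl_on ?Q (Sim (Def_obj R G))"
  proof (rule refl_onI)
    fix C assume C: "C \<in> ?Q"
    then obtain \<xi> where \<xi>: "\<xi> \<in> MC R (formal (Nor G))" "C = gauge_class R (Nor G) \<xi>"
      by (auto simp: Nor.gauge_quotient_eq)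
    then have "(\<xi>, \<xi>) \<in> MC_sim R G"
      using Nor.MC_carrier[of \<xi>] by (auto simp: MC_sim_iff Nor.formal_carrier intro: Nor.cong_refl)
    then show "(C, C) \<in> Sim (Def_obj R G)"
      using C \<xi> Nor.gauge_class_refl by (auto simp: Sim)
  qed
  show "sym (Sim (Def_obj R G))"
    by (rule symI) (auto simp: Sim MC_sim_iff intro: Nor.cong_sym)
  show "trans (Sim (Def_obj R G))"
  proof (rule transI)
    fix C D F assume "(C, D) \<in> Sim (Def_obj R G)" "(D, F) \<in> Sim (Def_obj R G)"
    then obtain \<xi>1 \<xi>2 \<eta>2 \<eta>3 where Q: "C \<in> ?Q" "D \<in> ?Q" "F \<in> ?Q"
      and mem: "\<xi>1 \<in> C" "\<xi>2 \<in> D" "\<eta>2 \<in> D" "\<eta>3 \<in> F"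
      and sim: "(\<xi>1, \<xi>2) \<in> MC_sim R G" "(\<eta>2, \<eta>3) \<in> MC_sim R G"
      by (auto simp: Sim)
    \<comment> \<open>The two relations meet in \<open>D\<close> at different representatives. The
      gauge element that moves \<open>\<eta>2\<close> to \<open>\<xi>2\<close> is applied to
      \<open>\<eta>3\<close> as well, which stays in its class \<open>F\<close>.\<close>
    have "\<xi>2 \<in> gauge_class R (Nor G) \<eta>2"
      using Nor.gauge_quotientE(2)[OF Q(2) mem(3)] mem(2) by simp
    then obtain x where x: "x \<in> carrier (Deg (formal (Nor G)) 0)" "\<xi>2 = gauge_act R (Nor G) x \<eta>2"
      unfolding Nor.gauge_class_eq by blast
    have "(\<xi>2, gauge_act R (Nor G) x \<eta>3) \<in> MC_sim R G"
      using MC_sim_gauge_act[OF sim(2) x(1)] x(2) by simp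
    then have "(\<xi>1, gauge_act R (Nor G) x \<eta>3) \<in> MC_sim R G"
      using sim(1) by (auto simp: MC_sim_iff intro: Nor.cong_trans)
    moreover have "gauge_act R (Nor G) x \<eta>3 \<in> F"
      using Nor.gauge_quotientE(2)[OF Q(3) mem(4)] x(1) unfolding Nor.gauge_class_eq by blast
    ultimately show "(C, F) \<in> Sim (Def_obj R G)"
      using Q mem by (auto simp: Sim)
  qed
qed

lemma coisotropic_set_Def_obj: "coisotropic_set (Def_obj R G)"
proof -
  have "siota (Def_obj R G) \<in> SNor (Def_obj R G) \<rightarrow> STot (Def_obj R G)"
    using iota.induced_map_funcset by (simp add: Def_obj_def PiE_def)
  moreover have "SNor (Def_obj R G) = gauge_quotient R (Nor G)"
    by (simp add: Def_obj_def)
  ultimately show ?thesis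
    using equiv_Sim by (simp add: coisotropic_set_def)
qed

lemma Def_well_defined_obj: "Def_well_defined_obj R G"
  by (simp add: Def_well_defined_obj_def Def_obj_def Tot.partition_gauge_quotient
      Nor.partition_gauge_quotient iota.formal_map_MC iota.induced_map_class)

end

locale rat_codgla_map = G: rat_codgla R G + H: rat_codgla R H
  for R :: "('r, 'm) ring_scheme" and G :: "('r, 'a, 'b) codgla" and H :: "('r, 'c, 'd) codgla" +
  fixes \<Phi>
  assumes map: "\<Phi> \<in> coisotropic_dgla_maps R G H"
begin

sublocale tot: rat_dgla_map R "Tot G" "Tot H" "fst \<Phi>"
  using map by (auto simp: rat_dgla_map_def rat_dgla_map_axioms_def G.Tot.rat_dgla_axioms
      H.Tot.rat_dgla_axioms coisotropic_dgla_maps_def)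

sublocale nor: rat_dgla_map R "Nor G" "Nor H" "snd \<Phi>"
  using map by (auto simp: rat_dgla_map_def rat_dgla_map_axioms_def G.Nor.rat_dgla_axioms
      H.Nor.rat_dgla_axioms coisotropic_dgla_maps_def)

lemma Def_well_defined_mor: "Def_well_defined_mor R G H \<Phi>"
  by (simp add: Def_well_defined_mor_def Def_mor_def tot.formal_map_MC nor.formal_map_MC
      tot.induced_map_class nor.induced_map_class)

lemma MC_sim_map:
  assumes "(\<xi>, \<eta>) \<in> MC_sim R G"
  shows "(formal_map (snd \<Phi> 1) \<xi>, formal_map (snd \<Phi> 1) \<eta>) \<in> MC_sim R H"
proof -
  have "snd \<Phi> 1 x \<in> Ideal0 H 1" if "x \<in> Ideal0 G 1" for x
    using map that by (auto simp: coisotropic_dgla_maps_def image_subset_iff)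
  then have "H.Nor.cong (snd \<Phi> 1 x) (snd \<Phi> 1 y)" if "G.Nor.cong x y" for x y
    using that by (auto simp: G.Nor.cong_def H.Nor.cong_def simp flip: nor.minus)
  then show ?thesis
    using assms nor.formal_map_MC by (simp add: G.MC_sim_iff H.MC_sim_iff) (simp add: formal_map_def)
qed

lemma Def_mor_in_Hom: "Def_mor R G H \<Phi> \<in> coisotropic_set_maps (Def_obj R G) (Def_obj R H)"
proof -
  let ?t = "induced_map R (Tot G) (Tot H) (fst \<Phi> 1)" and ?n = "induced_map R (Nor G) (Nor H) (snd \<Phi> 1)"
  have "?t (induced_map R (Nor G) (Tot G) (iota G 1) C) =
      induced_map R (Nor H) (Tot H) (iota H 1) (?n C)" if C: "C \<in> gauge_quotient R (Nor G)" for C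
  proof -
    obtain \<xi> where \<xi>: "\<xi> \<in> MC R (formal (Nor G))" and C: "C = gauge_class R (Nor G) \<xi>"
      using C by (auto simp: G.Nor.gauge_quotient_eq)
    have "fst \<Phi> 1 (iota G 1 x) = iota H 1 (snd \<Phi> 1 x)" if "x \<in> carrier (Deg (Nor G) 1)" for x
      using map that by (auto simp: coisotropic_dgla_maps_def)
    then have "formal_map (fst \<Phi> 1) (formal_map (iota G 1) \<xi>) =
        formal_map (iota H 1) (formal_map (snd \<Phi> 1) \<xi>)"
      using G.Nor.MC_carrier[OF \<xi>] by (simp add: formal_map_def G.Nor.formal_carrier)
    then show ?thesis
      by (simp add: C \<xi> G.iota.induced_map_class H.iota.induced_map_class tot.induced_map_class
          nor.induced_map_class G.iota.formal_map_MC nor.formal_map_MC)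
  qed
  moreover have "(?n C, ?n D) \<in> Sim (Def_obj R H)" if Sim: "(C, D) \<in> Sim (Def_obj R G)" for C D
  proof -
    obtain \<xi> \<eta> where CD: "C \<in> gauge_quotient R (Nor G)" "D \<in> gauge_quotient R (Nor G)"
      and mem: "\<xi> \<in> C" "\<eta> \<in> D" and sim: "(\<xi>, \<eta>) \<in> MC_sim R G"
      using Sim by (auto simp: Def_obj_def)
    have "formal_map (snd \<Phi> 1) \<xi> \<in> ?n C" "formal_map (snd \<Phi> 1) \<eta> \<in> ?n D"
      using G.Nor.gauge_quotientE[OF CD(1) mem(1)] G.Nor.gauge_quotientE[OF CD(2) mem(2)]
        nor.induced_map_class H.Nor.gauge_class_refl nor.formal_map_MC by simp_all
    then show ?thesis
      using MC_sim_map[OF sim] nor.induced_map_funcset CD by (auto simp: Def_obj_def)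
  qed
  ultimately show ?thesis
    using tot.induced_map_funcset nor.induced_map_funcset
    by (auto simp: Def_mor_def coisotropic_set_maps_def) (auto simp: Def_obj_def)
qed

end

section \<open>The categories of coisotropic DGLAs and coisotropic sets\<close>

lemma dgla_maps_closed:
  "\<phi> \<in> dgla_maps R L K \<Longrightarrow> x \<in> carrier (Deg L i) \<Longrightarrow> \<phi> i x \<in> carrier (Deg K i)"
  using linear_mapsD(1)[of "\<phi> i" R "Deg L i" "Deg K i"] by (simp add: dgla_maps_def)

lemma linear_maps_ident:
  assumes "module R M"
  shows "(\<lambda>x\<in>carrier M. x) \<in> linear_maps R M M"
proof -
  interpret module R M by fact
  show ?thesis by (simp add: linear_maps_def)
qed

lemma linear_maps_compose:
  assumes "module R M" "f \<in> linear_maps R M N" "g \<in> linear_maps R N P"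
  shows "compose (carrier M) g f \<in> linear_maps R M P"
proof -
  interpret module R M by fact
  show ?thesis
    using assms(2,3) by (simp add: linear_maps_def compose_def Pi_iff)
qed

lemma (in dgla) dgla_maps_ident: "(\<lambda>i. \<lambda>x\<in>carrier (Deg L i). x) \<in> dgla_maps R L L"
  by (simp add: dgla_maps_def linear_maps_ident module_Deg)

lemma (in dgla) dgla_maps_compose:
  assumes \<phi>: "\<phi> \<in> dgla_maps R L K" and \<psi>: "\<psi> \<in> dgla_maps R K P"
  shows "(\<lambda>i. compose (carrier (Deg L i)) (\<psi> i) (\<phi> i)) \<in> dgla_maps R L P"
proof -
  have "compose (carrier (Deg L i)) (\<psi> i) (\<phi> i) \<in> linear_maps R (Deg L i) (Deg P i)" for i
    using \<phi> \<psi> by (intro linear_maps_compose[OF module_Deg]) (auto simp: dgla_maps_def)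
  then show ?thesis
    using \<phi> \<psi> dgla_maps_closed[OF \<phi>] by (simp add: dgla_maps_def compose_eq)
qed

lemma (in coisotropic_dgla) Ideal0_carrier: "x \<in> Ideal0 G i \<Longrightarrow> x \<in> carrier (Deg (Nor G) i)"
  using subgroup.mem_carrier[OF submodule.axioms(1)[OF Ideal0_submodule]] by fastforce

lemma (in coisotropic_dgla) ident_maps:
  "(\<lambda>i. \<lambda>x\<in>carrier (Deg (Tot G) i). x, \<lambda>i. \<lambda>x\<in>carrier (Deg (Nor G) i). x)
    \<in> coisotropic_dgla_maps R G G"
  using dgla.dgla_maps_ident[OF Tot] dgla.dgla_maps_ident[OF Nor] dgla_maps_closed[OF iota]
  by (auto simp: coisotropic_dgla_maps_def Ideal0_carrier)

lemma (in coisotropic_dgla) compose_maps: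
  assumes "\<Phi> \<in> coisotropic_dgla_maps R G H" and "\<Psi> \<in> coisotropic_dgla_maps R H K"
  shows "(\<lambda>i. compose (carrier (Deg (Tot G) i)) (fst \<Psi> i) (fst \<Phi> i),
      \<lambda>i. compose (carrier (Deg (Nor G) i)) (snd \<Psi> i) (snd \<Phi> i)) \<in> coisotropic_dgla_maps R G K"
proof -
  obtain \<Phi>t \<Phi>n \<Psi>t \<Psi>n where \<Phi>\<Psi>: "\<Phi> = (\<Phi>t, \<Phi>n)" "\<Psi> = (\<Psi>t, \<Psi>n)"
    by fastforce
  have maps: "\<Phi>t \<in> dgla_maps R (Tot G) (Tot H)" "\<Phi>n \<in> dgla_maps R (Nor G) (Nor H)"
      "\<Psi>t \<in> dgla_maps R (Tot H) (Tot K)" "\<Psi>n \<in> dgla_maps R (Nor H) (Nor K)"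
    and comm: "\<And>i x. x \<in> carrier (Deg (Nor G) i) \<Longrightarrow> \<Phi>t i (iota G i x) = iota H i (\<Phi>n i x)"
      "\<And>i x. x \<in> carrier (Deg (Nor H) i) \<Longrightarrow> \<Psi>t i (iota H i x) = iota K i (\<Psi>n i x)"
    and ideal: "\<And>i x. x \<in> Ideal0 G i \<Longrightarrow> \<Phi>n i x \<in> Ideal0 H i"
      "\<And>i x. x \<in> Ideal0 H i \<Longrightarrow> \<Psi>n i x \<in> Ideal0 K i"
    using assms by (auto simp: \<Phi>\<Psi> coisotropic_dgla_maps_def image_subset_iff)
  show ?thesis
    using dgla.dgla_maps_compose[OF Tot maps(1,3)] dgla.dgla_maps_compose[OF Nor maps(2,4)]
    by (simp add: \<Phi>\<Psi> coisotropic_dgla_maps_def image_subset_iff compose_eq comm ideal Ideal0_carrier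
        dgla_maps_closed[OF iota] dgla_maps_closed[OF maps(2)])
qed

lemma coisotropic_dgla_mapsD:
  assumes "\<Phi> \<in> coisotropic_dgla_maps R G H"
  shows "fst \<Phi> i \<in> carrier (Deg (Tot G) i) \<rightarrow>\<^sub>E carrier (Deg (Tot H) i)"
    and "snd \<Phi> i \<in> carrier (Deg (Nor G) i) \<rightarrow>\<^sub>E carrier (Deg (Nor H) i)"
  using assms by (auto simp: coisotropic_dgla_maps_def PiE_iff dgla_maps_closed)

lemma is_category_coisotropic_dgla:
  fixes R :: "('r, 'm) ring_scheme"
  shows "is_category (coisotropic_dgla_cat R ::
    (('r, 'a, 'b) codgla, (int \<Rightarrow> 'a \<Rightarrow> 'a) \<times> (int \<Rightarrow> 'b \<Rightarrow> 'b)) cat)"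
  unfolding is_category_def
proof (intro conjI ballI)
  let ?C = "coisotropic_dgla_cat R"
  show "Ident ?C G \<in> Hom ?C G G" if "G \<in> Obj ?C" for G :: "('r, 'a, 'b) codgla"
    using coisotropic_dgla.ident_maps that by (simp add: coisotropic_dgla_cat_def)
  fix G H :: "('r, 'a, 'b) codgla" assume "G \<in> Obj ?C" "H \<in> Obj ?C"
  then have G: "coisotropic_dgla R G" and H: "coisotropic_dgla R H"
    by (simp_all add: coisotropic_dgla_cat_def)
  fix \<Phi> assume "\<Phi> \<in> Hom ?C G H"
  then have \<Phi>: "\<Phi> \<in> coisotropic_dgla_maps R G H"
    by (simp add: coisotropic_dgla_cat_def)
  \<comment> \<open>Off the carriers both sides are \<open>undefined\<close>, because \<Phi> is
    extensional.\<close>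
  show "Comp ?C G G H \<Phi> (Ident ?C G) = \<Phi>" "Comp ?C G H H (Ident ?C H) \<Phi> = \<Phi>"
    using coisotropic_dgla_mapsD[OF \<Phi>]
    by (auto simp: coisotropic_dgla_cat_def prod_eq_iff fun_eq_iff compose_def PiE_iff
        intro: extensional_arb[symmetric])
  fix K :: "('r, 'a, 'b) codgla" and \<Psi> assume "\<Psi> \<in> Hom ?C H K"
  then have \<Psi>: "\<Psi> \<in> coisotropic_dgla_maps R H K"
    by (simp add: coisotropic_dgla_cat_def)
  show "Comp ?C G H K \<Psi> \<Phi> \<in> Hom ?C G K"
    using coisotropic_dgla.compose_maps[OF G \<Phi> \<Psi>] by (simp add: coisotropic_dgla_cat_def)
  fix P :: "('r, 'a, 'b) codgla" and \<Omega>
  show "Comp ?C G K P \<Omega> (Comp ?C G H K \<Psi> \<Phi>) = Comp ?C G H P (Comp ?C H K P \<Omega> \<Psi>) \<Phi>"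
    using coisotropic_dgla_mapsD[OF \<Phi>]
    by (auto simp: coisotropic_dgla_cat_def fun_eq_iff compose_def PiE_iff)
qed

lemma is_category_coisotropic_set:
  "is_category (coisotropic_set_cat :: (('p, 'q) coiso_set, ('p \<Rightarrow> 'p) \<times> ('q \<Rightarrow> 'q)) cat)"
  unfolding is_category_def
proof (intro conjI ballI)
  let ?C = coisotropic_set_cat
  have Sim: "x \<in> SNor M \<and> y \<in> SNor M" if "coisotropic_set M" "(x, y) \<in> Sim M"
    for x y and M :: "('p, 'q) coiso_set"
    using that by (auto simp: coisotropic_set_def equiv_def)
  have siota: "siota M x \<in> STot M" if "coisotropic_set M" "x \<in> SNor M"
    for x and M :: "('p, 'q) coiso_set"
    using that by (auto simp: coisotropic_set_def)
  show "Ident ?C M \<in> Hom ?C M M" if "M \<in> Obj ?C" for M :: "('p, 'q) coiso_set"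
    using that Sim siota by (auto simp: coisotropic_set_cat_def coisotropic_set_maps_def)
  fix M N :: "('p, 'q) coiso_set" assume "M \<in> Obj ?C" "N \<in> Obj ?C"
  then have M: "coisotropic_set M" and N: "coisotropic_set N"
    by (simp_all add: coisotropic_set_cat_def)
  fix f assume "f \<in> Hom ?C M N"
  then have f: "f \<in> coisotropic_set_maps M N"
    by (simp add: coisotropic_set_cat_def)
  then have f': "fst f \<in> STot M \<rightarrow>\<^sub>E STot N" "snd f \<in> SNor M \<rightarrow>\<^sub>E SNor N"
    by (auto simp: coisotropic_set_maps_def)
  show "Comp ?C M M N f (Ident ?C M) = f" "Comp ?C M N N (Ident ?C N) f = f"
    using f' by (auto simp: coisotropic_set_cat_def prod_eq_iff fun_eq_iff compose_def PiE_iff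
        intro: extensional_arb[symmetric])
  fix P :: "('p, 'q) coiso_set" and g assume "g \<in> Hom ?C N P"
  then have g: "g \<in> coisotropic_set_maps N P"
    by (simp add: coisotropic_set_cat_def)
  show "Comp ?C M N P g f \<in> Hom ?C M P"
    using f g Sim[OF M] siota[OF M]
    by (auto simp: coisotropic_set_cat_def coisotropic_set_maps_def compose_def PiE_iff)
  fix Q :: "('p, 'q) coiso_set" and h
  show "Comp ?C M P Q h (Comp ?C M N P g f) = Comp ?C M N Q (Comp ?C N P Q h g) f"
    using f' by (auto simp: coisotropic_set_cat_def fun_eq_iff compose_def PiE_iff)
qed

section \<open>Identities and composites\<close>

lemma (in rat_dgla) induced_map_ident:
  "induced_map R L L (\<lambda>x\<in>carrier (Deg L 1). x) = (\<lambda>C\<in>gauge_quotient R L. C)"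
proof -
  interpret ident: rat_dgla_map R L L "\<lambda>i. \<lambda>x\<in>carrier (Deg L i). x"
    by (simp add: rat_dgla_map_def rat_dgla_map_axioms_def rat_dgla_axioms dgla_maps_ident)
  show ?thesis
  proof
    fix C show "induced_map R L L (\<lambda>x\<in>carrier (Deg L 1). x) C = (\<lambda>C\<in>gauge_quotient R L. C) C"
    proof (cases "C \<in> gauge_quotient R L")
      case True
      then obtain \<xi> where \<xi>: "\<xi> \<in> MC R (formal L)" "C = gauge_class R L \<xi>"
        by (auto simp: gauge_quotient_eq)
      then have "formal_map (\<lambda>x\<in>carrier (Deg L 1). x) \<xi> = \<xi>"
        using MC_carrier[of \<xi>] by (simp add: formal_map_def formal_carrier)
      then show ?thesis
        using True ident.induced_map_class[OF \<xi>(1)] \<xi>(2) by simp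
    qed (simp add: induced_map_def)
  qed
qed

text \<open>On the quotient both sides are computed at a representative, whose coefficients lie in
  the carrier where \<open>compose\<close> is the plain composite; elsewhere both are
  \<open>undefined\<close>.\<close>

lemma induced_map_compose:
  assumes \<phi>: "rat_dgla_map R L K \<phi>" and \<psi>: "rat_dgla_map R K P \<psi>"
  shows "induced_map R L P (compose (carrier (Deg L 1)) (\<psi> 1) (\<phi> 1)) =
    compose (gauge_quotient R L) (induced_map R K P (\<psi> 1)) (induced_map R L K (\<phi> 1))"
proof
  have L: "rat_dgla R L" and P: "rat_dgla R P"
    using \<phi> \<psi> by (simp_all add: rat_dgla_map_def)
  have comp: "rat_dgla_map R L P (\<lambda>i. compose (carrier (Deg L i)) (\<psi> i) (\<phi> i))"
    using L P dgla.dgla_maps_compose[OF rat_dgla.axioms(1)[OF L] rat_dgla_map.map[OF \<phi>] rat_dgla_map.map[OF \<psi>]]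
    by (simp add: rat_dgla_map_def rat_dgla_map_axioms_def)
  fix C show "induced_map R L P (compose (carrier (Deg L 1)) (\<psi> 1) (\<phi> 1)) C =
    compose (gauge_quotient R L) (induced_map R K P (\<psi> 1)) (induced_map R L K (\<phi> 1)) C"
  proof (cases "C \<in> gauge_quotient R L")
    case True
    then obtain \<xi> where \<xi>: "\<xi> \<in> MC R (formal L)" and C: "C = gauge_class R L \<xi>"
      by (auto simp: rat_dgla.gauge_quotient_eq[OF L])
    have "formal_map (compose (carrier (Deg L 1)) (\<psi> 1) (\<phi> 1)) \<xi> =
        formal_map (\<psi> 1) (formal_map (\<phi> 1) \<xi>)"
      using rat_dgla.MC_carrier[OF L \<xi>]
      by (simp add: formal_map_def rat_dgla.formal_carrier[OF L] compose_eq)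
    then show ?thesis
      using True \<xi> C rat_dgla_map.induced_map_class[OF comp \<xi>] rat_dgla_map.induced_map_class[OF \<phi> \<xi>]
        rat_dgla_map.induced_map_class[OF \<psi> rat_dgla_map.formal_map_MC[OF \<phi> \<xi>]]
      by (simp add: compose_eq)
  qed (simp add: induced_map_def compose_def)
qed

theorem proposition3p13:
  fixes R :: "('r, 'm) ring_scheme"
  assumes "cring R" and "contains_rationals R"
  shows "is_functor
      (coisotropic_dgla_cat R ::
        (('r, 'a, 'b) codgla, (int \<Rightarrow> 'a \<Rightarrow> 'a) \<times> (int \<Rightarrow> 'b \<Rightarrow> 'b)) cat)
      (coisotropic_set_cat ::
        (((nat \<Rightarrow> 'a) set, (nat \<Rightarrow> 'b) set) coiso_set,
         ((nat \<Rightarrow> 'a) set \<Rightarrow> (nat \<Rightarrow> 'a) set) \<times> ((nat \<Rightarrow> 'b) set \<Rightarrow> (nat \<Rightarrow> 'b) set)) cat)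
      (Def_obj R) (Def_mor R)
    \<and> (\<forall>G :: ('r, 'a, 'b) codgla. coisotropic_dgla R G \<longrightarrow> Def_well_defined_obj R G)
    \<and> (\<forall>(G :: ('r, 'a, 'b) codgla) (H :: ('r, 'a, 'b) codgla).
         coisotropic_dgla R G \<longrightarrow> coisotropic_dgla R H \<longrightarrow>
         (\<forall>\<Phi> \<in> coisotropic_dgla_maps R G H. Def_well_defined_mor R G H \<Phi>))"
proof -
  have obj: "rat_codgla R G" if "coisotropic_dgla R G" for G :: "('r, 'a, 'b) codgla"
    using that assms by (simp add: rat_codgla_def rat_codgla_axioms_def)
  have mor: "rat_codgla_map R G H \<Phi>"
    if "coisotropic_dgla R G" "coisotropic_dgla R H" "\<Phi> \<in> coisotropic_dgla_maps R G H"
    for G H :: "('r, 'a, 'b) codgla" and \<Phi>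
    using that by (simp add: rat_codgla_map_def rat_codgla_map_axioms_def obj)
  have ident: "Def_mor R G G (\<lambda>i. \<lambda>x\<in>carrier (Deg (Tot G) i). x, \<lambda>i. \<lambda>x\<in>carrier (Deg (Nor G) i). x) =
      (\<lambda>C\<in>STot (Def_obj R G). C, \<lambda>C\<in>SNor (Def_obj R G). C)"
    if "coisotropic_dgla R G" for G :: "('r, 'a, 'b) codgla"
  proof -
    have "rat_dgla R (Tot G)" "rat_dgla R (Nor G)"
      using that assms by (simp_all add: rat_dgla_def rat_dgla_axioms_def coisotropic_dgla_def)
    then show ?thesis
      by (simp add: Def_mor_def Def_obj_def rat_dgla.induced_map_ident)
  qed
  have comp: "Def_mor R G K (\<lambda>i. compose (carrier (Deg (Tot G) i)) (fst \<Psi> i) (fst \<Phi> i),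
        \<lambda>i. compose (carrier (Deg (Nor G) i)) (snd \<Psi> i) (snd \<Phi> i)) =
      (compose (STot (Def_obj R G)) (fst (Def_mor R H K \<Psi>)) (fst (Def_mor R G H \<Phi>)),
       compose (SNor (Def_obj R G)) (snd (Def_mor R H K \<Psi>)) (snd (Def_mor R G H \<Phi>)))"
    if "coisotropic_dgla R G" "coisotropic_dgla R H" "coisotropic_dgla R K"
      "\<Phi> \<in> coisotropic_dgla_maps R G H" "\<Psi> \<in> coisotropic_dgla_maps R H K"
    for G H K :: "('r, 'a, 'b) codgla" and \<Phi> \<Psi>
  proof -
    have \<Phi>: "rat_dgla_map R (Tot G) (Tot H) (fst \<Phi>)" "rat_dgla_map R (Nor G) (Nor H) (snd \<Phi>)"
      and \<Psi>: "rat_dgla_map R (Tot H) (Tot K) (fst \<Psi>)" "rat_dgla_map R (Nor H) (Nor K) (snd \<Psi>)"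
      using that assms
      by (auto simp: rat_dgla_map_def rat_dgla_map_axioms_def rat_dgla_def rat_dgla_axioms_def
          coisotropic_dgla_def coisotropic_dgla_maps_def)
    show ?thesis
      by (simp add: Def_mor_def Def_obj_def induced_map_compose[OF \<Phi>(1) \<Psi>(1)]
          induced_map_compose[OF \<Phi>(2) \<Psi>(2)])
  qed
  show ?thesis
    unfolding is_functor_def
    using rat_codgla.coisotropic_set_Def_obj[OF obj] rat_codgla.Def_well_defined_obj[OF obj]
      rat_codgla_map.Def_mor_in_Hom[OF mor] rat_codgla_map.Def_well_defined_mor[OF mor]
    by (intro conjI is_category_coisotropic_dgla is_category_coisotropic_set)
      (simp_all add: coisotropic_dgla_cat_def coisotropic_set_cat_def ident comp)
qed

end
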